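(* Let $\mathbb{F}_q$ be a finite field, let $\widehat{K}=\mathbb{F}_q((X^{-1}))$ be the field of formal Laurent series in the variable $X^{-1}$ over $\mathbb{F}_q$, with absolute value $|\cdot|_\infty$, and let $\mu$ be a Haar measure on the locally compact additive group $\widehat{K}$. Let $\varphi:\mathbb{R}_+\to\,]0,+\infty[$ be a map such that $u\mapsto \log\varphi(e^u)$ is Lipschitz. If the integral $\int_{1}^{+\infty} \varphi(t)/t\,dt$ diverges (resp. converges), then for $\mu$-almost every $x\in\widehat{K}$, $$\liminf\;\frac{h(\beta)}{\varphi(h(\beta))}\;|x-\beta|_\infty=0\quad(\text{resp. } =+\infty)\;,$$ where the lower limit is taken over the quadratic irrational elements $\beta$ in $\widehat{K}$, in any (resp. some) congruence class, with $h(\beta)\to+\infty$.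
   Context: The absolute value is $|f|_\infty=q^{-\nu(f)}$ for $f=\sum_{i=n}^\infty a_iX^{-i}$ with $n\in\mathbb{Z}$, $a_n\neq0$ and $\nu(f)=n$; and $|0|_\infty=0$. An element of $\widehat{K}$ is irrational if it does not belong to the subfield $\mathbb{F}_q(X)$, and quadratic if it is a solution of a quadratic equation with coefficients in $\mathbb{F}_q(X)$. The group $\mathrm{SL}_2(\mathbb{F}_q[X])$ acts by homographies on the set of quadratic irrational elements of $\widehat{K}$; two of these are congruent if they are in the same orbit, and a congruence class is such an orbit. For a quadratic irrational $\alpha\in\widehat{K}$ with Galois conjugate $\alpha^*$ (the other root of its minimal polynomial over $\mathbb{F}_q(X)$), its height is $h(\alpha)=|\alpha-\alpha^*|_\infty^{-1}$. *)

theory Defs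
  imports
    "HOL-Analysis.Analysis"
    "HOL-Computational_Algebra.Computational_Algebra"
begin

text \<open>
  The field $\mathbb{F}_q((X^{-1}))$ is the type of formal Laurent series over a finite field
  type, whose formal variable \<open>fls_X\<close> plays the role of $X^{-1}$; thus $X$ is \<open>fls_X_inv\<close>,
  the valuation $\nu$ is \<open>fls_subdegree\<close>, and $q$ is \<open>CARD('a)\<close>.  The library metric on
  Laurent series is $2^{-\nu(f-g)}$, which induces the same topology as the absolute value below.
\<close>

definition abs_inf :: "'a::{field,finite} fls \<Rightarrow> real" where
  "abs_inf f = (if f = 0 then 0 else real CARD('a) powi (- fls_subdegree f))"

definition emb_poly :: "'a::field poly \<Rightarrow> 'a fls" where
  "emb_poly p = poly (map_poly fls_const p) fls_X_inv"

definition rat_fls :: "'a::field fls set" where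
  "rat_fls = {emb_poly p / emb_poly r | p r. r \<noteq> 0}"

definition quad_irr :: "'a::field fls set" where
  "quad_irr = {\<alpha>. \<alpha> \<notin> rat_fls \<and>
     (\<exists>a\<in>rat_fls. \<exists>b\<in>rat_fls. \<exists>c\<in>rat_fls. a \<noteq> 0 \<and> a * \<alpha>\<^sup>2 + b * \<alpha> + c = 0)}"

definition over_rat :: "'a::field fls poly \<Rightarrow> bool" where
  "over_rat p \<longleftrightarrow> (\<forall>i. coeff p i \<in> rat_fls)"

text \<open>Only meaningful for elements that are algebraic over \<open>rat_fls\<close>.\<close>

definition min_poly :: "'a::field fls \<Rightarrow> 'a fls poly" where
  "min_poly \<alpha> = (THE p. over_rat p \<and> lead_coeff p = 1 \<and> poly p \<alpha> = 0 \<and>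
     (\<forall>r. over_rat r \<and> r \<noteq> 0 \<and> poly r \<alpha> = 0 \<longrightarrow> degree p \<le> degree r))"

text \<open>
  The other root of the minimal polynomial of a quadratic irrational.  It lies in the same field,
  since the sum of the two roots is a coefficient.
\<close>

definition galois_conj :: "'a::field fls \<Rightarrow> 'a fls" where
  "galois_conj \<alpha> = (THE \<beta>. min_poly \<alpha> = [:- \<alpha>, 1:] * [:- \<beta>, 1:])"

definition height :: "'a::{field,finite} fls \<Rightarrow> real" where
  "height \<alpha> = inverse (abs_inf (\<alpha> - galois_conj \<alpha>))"

definition homography :: "'a::field poly ^ 2 ^ 2 \<Rightarrow> 'a fls \<Rightarrow> 'a fls" where
  "homography A \<alpha> = (emb_poly (A $ 1 $ 1) * \<alpha> + emb_poly (A $ 1 $ 2)) /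
                     (emb_poly (A $ 2 $ 1) * \<alpha> + emb_poly (A $ 2 $ 2))"

definition congruence_class :: "'a::field fls \<Rightarrow> 'a fls set" where
  "congruence_class \<alpha> = {homography A \<alpha> | A. det A = 1}"

definition congruence_classes :: "'a::field fls set set" where
  "congruence_classes = congruence_class ` quad_irr"

text \<open>
  A nonzero translation invariant Borel measure, finite on compact sets.  Regularity need not be
  required, as the field is locally compact and second countable.
\<close>

definition haar_measure :: "'a::{field,finite} fls measure \<Rightarrow> bool" where
  "haar_measure \<mu> \<longleftrightarrow> sets \<mu> = sets borel \<and>
     (\<forall>a. \<forall>A\<in>sets borel. emeasure \<mu> ((+) a ` A) = emeasure \<mu> A) \<and>
     (\<forall>C. compact C \<longrightarrow> emeasure \<mu> C < \<infinity>) \<and>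
     emeasure \<mu> UNIV \<noteq> 0"

text \<open>
  The lower limit of $\frac{h(\beta)}{\varphi(h(\beta))}|x-\beta|_\infty$ over $\beta$ in \<open>C\<close>
  with $h(\beta) \to +\infty$.
\<close>

definition approx_liminf :: "(real \<Rightarrow> real) \<Rightarrow> 'a::{field,finite} fls set \<Rightarrow> 'a fls \<Rightarrow> ereal" where
  "approx_liminf \<phi> C x =
     Liminf (inf (filtercomap height at_top) (principal C))
       (\<lambda>\<beta>. ereal (height \<beta> / \<phi> (height \<beta>) * abs_inf (x - \<beta>)))"

end

theory Submission
  imports Defs
begin

text \<open>
  Two distinct elements $\beta, \beta'$ of one congruence class satisfy
  $|\beta - \beta'|_\infty \ge \kappa / \max(h(\beta), h(\beta'))$: the product of
  $|\beta - \beta'|_\infty$ with the corresponding distance of the conjugates is, up to the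
  factor $h(\beta) h(\beta')$, the norm of a nonzero element with bounded denominator.  Hence a ball
  contains few elements of a given height, and the convergent case is the Borel--Cantelli lemma.

  For the divergent case, Dirichlet's theorem, in a form that produces a whole matrix of determinant
  one, yields sufficiently many elements of height about $q^{4N}$ in every ball.  The separation
  bound makes the unions of small balls around the elements of the various heights quasi-independent
  in every ball, so that their limsup set has a uniformly positive proportion in each ball.
\<close>

subsection \<open>The absolute value and polynomials inside Laurent series\<close>

text \<open>The obstacle in the divergent case is that a homography also moves the conjugate, so the
  height of the image involves both c \<alpha> + d and c \<alpha>' + d. Replacing \<alpha> by
  \<alpha> + p with a polynomial p of large degree stays in the class and gives both roots the same
  absolute value, larger than 1. If |d| < |c|, both denominators are then |c| times a constant, and
  a Dirichlet matrix for x with denominator of degree n yields an element of height exactly a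
  constant times q^(2n). Dirichlet only gives n \<le> L. The points with n < L - 1 lie near
  fractions of small denominator, which fill at most 3/4 of a ball; for the others n is L - 1 or L,
  a window of heights with both ends included. Consecutive windows meet, so only L = 2N is used:
  this is the origin of q^(4N). The targets at time N have radius q^(-4N) times a capped multiple of
  \<phi>(q^(4N)). Overlaps of two times cost a constant times the product of the weights, so a run
  of times of small total weight keeps half of its expected mass. The Lipschitz condition makes
  \<phi> nearly constant between consecutive powers of q, which turns the integral into a
  series.\<close>

lemma emb_poly_0 [simp]: "emb_poly 0 = 0"
  by (simp add: emb_poly_def)

lemma emb_poly_pCons: "emb_poly (pCons a p) = fls_const a + fls_X_inv * emb_poly p"
  by (cases "a = 0 \<and> p = 0") (auto simp: emb_poly_def map_poly_pCons)

lemma emb_poly_1 [simp]: "emb_poly 1 = 1"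
  by (simp add: one_pCons emb_poly_pCons)

lemma emb_poly_nth:
  "fls_nth (emb_poly p) i = (if i \<le> 0 then coeff p (nat (- i)) else 0)"
proof (induction p arbitrary: i)
  case (pCons a p)
  show ?case
  proof (cases "i \<le> 0")
    case True
    then show ?thesis
      by (cases "nat (- i)")
        (auto simp: emb_poly_pCons pCons.IH fls_X_inv_times_conv_shift nat_diff_distrib)
  next
    case False
    then show ?thesis by (simp add: emb_poly_pCons pCons.IH fls_X_inv_times_conv_shift)
  qed
qed simp

lemma emb_poly_add: "emb_poly (p + r) = emb_poly p + emb_poly r"
  by (intro fls_eqI) (simp add: emb_poly_nth)

lemma emb_poly_minus: "emb_poly (- p) = - emb_poly p"
  by (intro fls_eqI) (simp add: emb_poly_nth)

lemma emb_poly_diff: "emb_poly (p - r) = emb_poly p - emb_poly r"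
  by (intro fls_eqI) (simp add: emb_poly_nth)

lemma emb_poly_smult: "emb_poly (smult a p) = fls_const a * emb_poly p"
  by (intro fls_eqI) (simp add: emb_poly_nth)

lemma emb_poly_mult: "emb_poly (p * r) = emb_poly p * emb_poly r"
proof (induction p)
  case (pCons a p)
  then show ?case
    by (simp add: emb_poly_pCons emb_poly_add emb_poly_smult algebra_simps)
qed simp

lemma emb_poly_inj [simp]: "emb_poly p = emb_poly r \<longleftrightarrow> p = r"
proof
  assume eq: "emb_poly p = emb_poly r"
  show "p = r"
  proof (rule poly_eqI)
    fix n
    have "fls_nth (emb_poly p) (- int n) = fls_nth (emb_poly r) (- int n)"
      using eq by simp
    then show "coeff p n = coeff r n" by (simp add: emb_poly_nth)
  qed
qed simp

lemma emb_poly_eq_0_iff [simp]: "emb_poly p = 0 \<longleftrightarrow> p = 0"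
  using emb_poly_inj[of p 0] by (simp del: emb_poly_inj)

lemmas emb_poly_simps = emb_poly_add emb_poly_minus emb_poly_diff emb_poly_mult

lemma card_field_gt_1: "real CARD('a::{field,finite}) > 1"
proof -
  have "card {0, 1 :: 'a} \<le> CARD('a)" by (rule card_mono) auto
  then show ?thesis by simp
qed

lemma abs_inf_nonneg [simp]: "abs_inf f \<ge> 0"
  by (simp add: abs_inf_def)

lemma abs_inf_0 [simp]: "abs_inf 0 = 0"
  by (simp add: abs_inf_def)

lemma abs_inf_eq_0_iff [simp]: "abs_inf f = 0 \<longleftrightarrow> f = 0"
  using card_field_gt_1[where 'a='a] by (auto simp: abs_inf_def)

lemma abs_inf_pos_iff [simp]: "abs_inf f > 0 \<longleftrightarrow> f \<noteq> 0"
  using abs_inf_nonneg[of f] abs_inf_eq_0_iff[of f] by linarith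

lemma abs_inf_1 [simp]: "abs_inf 1 = 1"
  by (simp add: abs_inf_def)

lemma abs_inf_uminus [simp]: "abs_inf (- f) = abs_inf f"
  by (simp add: abs_inf_def)

lemma abs_inf_diff_commute: "abs_inf (f - g) = abs_inf (g - f)"
  by (metis abs_inf_uminus minus_diff_eq)

lemma abs_inf_mult: "abs_inf (f * g) = abs_inf f * abs_inf g"
  by (auto simp: abs_inf_def power_int_diff power_int_add field_simps power_int_minus)

lemma abs_inf_inverse: "abs_inf (inverse f) = inverse (abs_inf f)"
proof (cases "f = 0")
  case False
  then have "abs_inf f * abs_inf (inverse f) = 1"
    by (simp flip: abs_inf_mult)
  then show ?thesis by (simp add: inverse_unique)
qed simp

lemma abs_inf_divide: "abs_inf (f / g) = abs_inf f / abs_inf g"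
  by (simp add: divide_inverse abs_inf_mult abs_inf_inverse)

lemma abs_inf_power: "abs_inf (f ^ n) = abs_inf f ^ n"
  by (induction n) (simp_all add: abs_inf_mult)

lemma powi_le_iff: "1 < (q :: real) \<Longrightarrow> q powi a \<le> q powi b \<longleftrightarrow> a \<le> b"
  by (metis less_le_not_le linorder_le_less_linear power_int_strict_increasing power_int_increasing)

lemma powi_less_iff: "1 < (q :: real) \<Longrightarrow> q powi a < q powi b \<longleftrightarrow> a < b"
  by (simp add: powi_le_iff flip: not_le)

text \<open>The passage from sizes to coefficients: the ultrametric inequality and the description
  of balls by \<open>cyl\<close> are both read off from it.\<close>

lemma abs_inf_le_iff:
  "abs_inf (f :: 'a::{field,finite} fls) \<le> real CARD('a) powi (- k) \<longleftrightarrow> (\<forall>i<k. fls_nth f i = 0)"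
proof (cases "f = 0")
  case False
  then have "abs_inf f \<le> real CARD('a) powi (- k) \<longleftrightarrow> k \<le> fls_subdegree f"
    using card_field_gt_1[where 'a='a] by (simp add: abs_inf_def powi_le_iff)
  also have "\<dots> \<longleftrightarrow> (\<forall>i<k. fls_nth f i = 0)"
    using False fls_subdegree_geI[of f k] fls_eq0_below_subdegree[of _ f] by fastforce
  finally show ?thesis .
qed auto

lemma abs_inf_eq_powi:
  assumes "(f :: 'a::{field,finite} fls) \<noteq> 0"
  obtains k where "abs_inf f = real CARD('a) powi (- k)"
  using assms by (auto simp: abs_inf_def)

lemma abs_inf_add: "abs_inf (f + g) \<le> max (abs_inf f) (abs_inf (g :: 'a::{field,finite} fls))"
proof -
  have *: "abs_inf (f + g) \<le> abs_inf g" if "abs_inf f \<le> abs_inf g" for f g :: "'a fls"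
  proof (cases "g = 0")
    case False
    then obtain k where k: "abs_inf g = real CARD('a) powi (- k)"
      by (rule abs_inf_eq_powi)
    then have "\<forall>i<k. fls_nth f i = 0" "\<forall>i<k. fls_nth g i = 0"
      using that abs_inf_le_iff[of f k] abs_inf_le_iff[of g k] by simp_all
    then have "abs_inf (f + g) \<le> real CARD('a) powi (- k)"
      unfolding abs_inf_le_iff by simp
    then show ?thesis using k by simp
  qed (use that abs_inf_nonneg[of f] in \<open>simp add: order_antisym\<close>)
  show ?thesis
    using *[of f g] *[of g f] by (cases "abs_inf f \<le> abs_inf g") (auto simp: add.commute)
qed

lemma abs_inf_diff: "abs_inf (f - g) \<le> max (abs_inf f) (abs_inf g)"
  using abs_inf_add[of f "- g"] by simp

lemma abs_inf_triangle: "abs_inf (f - g) \<le> max (abs_inf (f - h)) (abs_inf (h - g))"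
  using abs_inf_add[of "f - h" "h - g"] by simp

lemma abs_inf_add_eq:
  assumes "abs_inf f < abs_inf g"
  shows "abs_inf (f + g) = abs_inf g" "abs_inf (g + f) = abs_inf g"
proof -
  have "abs_inf g \<le> max (abs_inf (f + g)) (abs_inf f)"
    using abs_inf_diff[of "f + g" f] by simp
  with abs_inf_add[of f g] assms show "abs_inf (f + g) = abs_inf g" by linarith
  then show "abs_inf (g + f) = abs_inf g" by (simp add: add.commute)
qed

lemma abs_inf_emb_poly:
  "abs_inf (emb_poly (p :: 'a::{field,finite} poly)) = (if p = 0 then 0 else real CARD('a) ^ degree p)"
proof (cases "p = 0")
  case False
  have "fls_subdegree (emb_poly p) = - int (degree p)"
    using False by (intro fls_subdegree_eqI) (auto simp: emb_poly_nth coeff_eq_0 zless_nat_conj)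
  with False show ?thesis by (simp add: abs_inf_def power_int_def)
qed simp

lemma abs_inf_emb_poly_ge_1: "p \<noteq> 0 \<Longrightarrow> abs_inf (emb_poly p) \<ge> 1"
  using card_field_gt_1[where 'a='a] by (simp add: abs_inf_emb_poly)

text \<open>The integer part of f collects the nonnegative powers of X; it supplies the partial
  quotients in \<open>dirichlet\<close>.\<close>

lemma emb_poly_part:
  fixes f :: "'a::{field,finite} fls"
  obtains p where "abs_inf (f - emb_poly p) \<le> inverse (real CARD('a))"
proof -
  \<comment> \<open>For positive valuation \<open>nat\<close> truncates, and the list holds only the
    constant coefficient, which is 0.\<close>
  define p where "p = Poly (map (\<lambda>i. fls_nth f (- int i)) [0..<Suc (nat (- fls_subdegree f))])"
  have "fls_nth (f - emb_poly p) i = 0" if "i < 1" for i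
    using that by (auto simp: p_def emb_poly_nth nth_default_def simp del: upt_Suc)
  then have "abs_inf (f - emb_poly p) \<le> real CARD('a) powi (- 1)"
    unfolding abs_inf_le_iff by blast
  then show ?thesis by (intro that[of p]) (simp add: power_int_minus)
qed

subsection \<open>Quadratic irrationals and their conjugates\<close>

lemma rat_fls_emb [simp]: "emb_poly p \<in> rat_fls"
  unfolding rat_fls_def by (force intro: exI[of _ p] exI[of _ 1])

lemma rat_fls_0 [simp]: "0 \<in> rat_fls" and rat_fls_1 [simp]: "1 \<in> rat_fls"
  using rat_fls_emb[of 0] rat_fls_emb[of 1] by simp_all

lemma rat_fls_add:
  assumes "x \<in> rat_fls" "y \<in> rat_fls"
  shows "x + y \<in> rat_fls"
proof -
  obtain p r p' r' where *: "x = emb_poly p / emb_poly r" "r \<noteq> 0"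
    "y = emb_poly p' / emb_poly r'" "r' \<noteq> 0"
    using assms by (auto simp: rat_fls_def)
  then have "x + y = emb_poly (p * r' + p' * r) / emb_poly (r * r')"
    by (simp add: emb_poly_simps add_frac_eq)
  then show ?thesis using * unfolding rat_fls_def by fastforce
qed

lemma rat_fls_mult:
  assumes "x \<in> rat_fls" "y \<in> rat_fls"
  shows "x * y \<in> rat_fls"
proof -
  obtain p r p' r' where *: "x = emb_poly p / emb_poly r" "r \<noteq> 0"
    "y = emb_poly p' / emb_poly r'" "r' \<noteq> 0"
    using assms by (auto simp: rat_fls_def)
  then have "x * y = emb_poly (p * p') / emb_poly (r * r')"
    by (simp add: emb_poly_simps)
  then show ?thesis using * unfolding rat_fls_def by fastforce
qed

lemma rat_fls_uminus: "x \<in> rat_fls \<Longrightarrow> - x \<in> rat_fls"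
  using rat_fls_mult[OF rat_fls_emb[of "- 1"], of x] by (simp add: emb_poly_minus)

lemma rat_fls_diff: "x \<in> rat_fls \<Longrightarrow> y \<in> rat_fls \<Longrightarrow> x - y \<in> rat_fls"
  using rat_fls_add[OF _ rat_fls_uminus[of y], of x] by simp

lemma rat_fls_inverse:
  assumes "x \<in> rat_fls"
  shows "inverse x \<in> rat_fls"
proof (cases "x = 0")
  case False
  obtain p r where *: "x = emb_poly p / emb_poly r" "r \<noteq> 0"
    using assms by (auto simp: rat_fls_def)
  with False have "inverse x = emb_poly r / emb_poly p" "p \<noteq> 0" by auto
  then show ?thesis unfolding rat_fls_def by blast
qed simp

lemma rat_fls_divide: "x \<in> rat_fls \<Longrightarrow> y \<in> rat_fls \<Longrightarrow> x / y \<in> rat_fls"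
  by (simp add: divide_inverse rat_fls_mult rat_fls_inverse)

lemmas rat_fls_intros = rat_fls_add rat_fls_diff rat_fls_mult rat_fls_divide rat_fls_uminus
  rat_fls_emb rat_fls_0 rat_fls_1

lemma irrational_degree_ge_2:
  assumes "\<alpha> \<notin> rat_fls" "over_rat r" "r \<noteq> 0" "poly r \<alpha> = 0"
  shows "degree r \<ge> 2"
proof (rule ccontr)
  assume "\<not> degree r \<ge> 2"
  then have "r = [:coeff r 0, coeff r 1:]"
    by (intro poly_eqI) (auto simp: coeff_pCons coeff_eq_0 split: nat.split)
  then have eq: "coeff r 0 + \<alpha> * coeff r 1 = 0" and "coeff r 0 \<noteq> 0 \<or> coeff r 1 \<noteq> 0"
    using assms(3,4) by (metis poly_pCons poly_0 mult_zero_right add.right_neutral, metis pCons_0_0)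
  then have "coeff r 1 \<noteq> 0" by auto
  with eq have "\<alpha> = - coeff r 0 / coeff r 1" by (simp add: field_simps add_eq_0_iff2)
  moreover have "- coeff r 0 / coeff r 1 \<in> rat_fls"
    using assms(2) by (intro rat_fls_intros) (auto simp: over_rat_def)
  ultimately show False using assms(1) by simp
qed

text \<open>(Y - \<alpha>)(Y - \<beta>) has rational coefficients and the least degree possible for
  an irrational root; two such monic polynomials differ by one of smaller degree that still vanishes
  at \<alpha>. This evaluates both \<open>THE\<close> operators at once.\<close>

lemma galois_conj_eqI:
  assumes "\<alpha> \<notin> rat_fls" "\<alpha> + \<beta> \<in> rat_fls" "\<alpha> * \<beta> \<in> rat_fls"
  shows "galois_conj \<alpha> = \<beta>"
proof -
  define p where "p = [:- \<alpha>, 1:] * [:- \<beta>, 1:]"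
  have p_eq: "p = [:\<alpha> * \<beta>, - (\<alpha> + \<beta>), 1:]" by (simp add: p_def)
  have p: "over_rat p" "lead_coeff p = 1" "poly p \<alpha> = 0" "degree p = 2"
    using assms rat_fls_uminus[OF assms(2)]
    by (auto simp: p_eq over_rat_def coeff_pCons algebra_simps split: nat.split)
  have "min_poly \<alpha> = p"
    unfolding min_poly_def
  proof (rule the_equality)
    show "over_rat p \<and> lead_coeff p = 1 \<and> poly p \<alpha> = 0 \<and>
      (\<forall>r. over_rat r \<and> r \<noteq> 0 \<and> poly r \<alpha> = 0 \<longrightarrow> degree p \<le> degree r)"
      using p irrational_degree_ge_2[OF assms(1)] by simp
  next
    fix r assume r: "over_rat r \<and> lead_coeff r = 1 \<and> poly r \<alpha> = 0 \<and>
      (\<forall>s. over_rat s \<and> s \<noteq> 0 \<and> poly s \<alpha> = 0 \<longrightarrow> degree r \<le> degree s)"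
    have "p \<noteq> 0" using p(4) by auto
    with r p have "degree r \<le> 2" by metis
    moreover have "degree r \<ge> 2" using r by (intro irrational_degree_ge_2[OF assms(1)]) auto
    ultimately have deg: "degree r = 2" by simp
    have "over_rat (r - p)"
      using r p(1) by (auto simp: over_rat_def intro: rat_fls_diff)
    moreover have "poly (r - p) \<alpha> = 0" using r p(3) by simp
    moreover have "degree (r - p) < 2"
    proof -
      have "degree (r - p) \<le> 2" using deg p(4) by (intro degree_diff_le) auto
      moreover have "coeff (r - p) 2 = 0" using r p(2,4) deg by simp
      ultimately show ?thesis
        by (metis degree_0 eq_zero_or_degree_less pos2 )
    qed
    ultimately show "r = p"
      using irrational_degree_ge_2[OF assms(1), of "r - p"] by fastforce
  qed
  then show ?thesis
    unfolding galois_conj_def p_def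
    by (intro the_equality) (auto simp: mult_cancel_left simp del: mult_pCons_left mult_pCons_right)
qed

text \<open>Polynomial coefficients matter because a nonzero polynomial has absolute value at least
  1, which is the source of the separation bound.\<close>

lemma quad_irrE:
  assumes "\<alpha> \<in> quad_irr"
  obtains A B C where "\<alpha> \<notin> rat_fls" "A \<noteq> 0" "emb_poly A * \<alpha>\<^sup>2 + emb_poly B * \<alpha> + emb_poly C = 0"
proof -
  obtain a b c where *: "\<alpha> \<notin> rat_fls" "a \<in> rat_fls" "b \<in> rat_fls" "c \<in> rat_fls"
    "a \<noteq> 0" "a * \<alpha>\<^sup>2 + b * \<alpha> + c = 0"
    using assms by (auto simp: quad_irr_def)
  obtain a1 a2 b1 b2 c1 c2 where **: "a = emb_poly a1 / emb_poly a2" "a2 \<noteq> 0"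
    "b = emb_poly b1 / emb_poly b2" "b2 \<noteq> 0" "c = emb_poly c1 / emb_poly c2" "c2 \<noteq> 0"
    using *(2-4) by (auto simp: rat_fls_def)
  let ?d = "emb_poly (a2 * b2 * c2)"
  have "emb_poly (a1 * b2 * c2) * \<alpha>\<^sup>2 + emb_poly (b1 * a2 * c2) * \<alpha> + emb_poly (c1 * a2 * b2)
    = ?d * (a * \<alpha>\<^sup>2 + b * \<alpha> + c)"
    using ** by (simp add: emb_poly_mult distrib_left)
  moreover have "a1 * b2 * c2 \<noteq> 0" using *(5) ** by auto
  ultimately show ?thesis using *(1,6) by (intro that[of "a1 * b2 * c2"]) auto
qed

text \<open>In characteristic two an inseparable quadratic irrational would be a square root of a
  rational function; but the fractional part of a square root of a polynomial squares to a
  polynomial of absolute value less than one, so it vanishes.\<close>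

lemma sqrt_rational_char_2:
  fixes \<alpha> :: "'a::{field,finite} fls"
  assumes "(2 :: 'a fls) = 0" "\<alpha>\<^sup>2 \<in> rat_fls"
  shows "\<alpha> \<in> rat_fls"
proof -
  obtain p r where pr: "\<alpha>\<^sup>2 = emb_poly p / emb_poly r" "r \<noteq> 0"
    using assms(2) by (auto simp: rat_fls_def)
  define y where "y = \<alpha> * emb_poly r"
  have y2: "y\<^sup>2 = emb_poly (p * r)"
    unfolding y_def power_mult_distrib pr(1) using pr(2) by (simp add: emb_poly_mult power2_eq_square)
  obtain s where s: "abs_inf (y - emb_poly s) \<le> inverse (real CARD('a))"
    by (rule emb_poly_part)
  also have "\<dots> < 1" using card_field_gt_1[where 'a='a] by (simp add: field_simps)
  finally have "abs_inf ((y - emb_poly s)\<^sup>2) < 1"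
    by (simp add: abs_inf_power abs_square_less_1)
  moreover have "(y - emb_poly s)\<^sup>2 = y\<^sup>2 - 2 * (y * emb_poly s) + (emb_poly s)\<^sup>2"
    by (simp add: power2_diff)
  \<comment> \<open>The cross term vanishes in characteristic two.\<close>
  then have sq: "(y - emb_poly s)\<^sup>2 = emb_poly (p * r + s * s)"
    unfolding assms(1) y2 by (simp add: emb_poly_add emb_poly_mult power2_eq_square)
  ultimately have "p * r + s * s = 0"
    using abs_inf_emb_poly_ge_1[of "p * r + s * s"] by force
  with sq have "y = emb_poly s" by simp
  then have "\<alpha> = emb_poly s / emb_poly r" using pr(2) by (simp add: y_def field_simps)
  then show ?thesis using pr(2) by (auto simp: rat_fls_def)
qed

section \<open>Homographies on a pair of conjugate roots, and the separation bound\<close>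

definition mobius :: "'a::field poly \<Rightarrow> 'a poly \<Rightarrow> 'a poly \<Rightarrow> 'a poly \<Rightarrow> 'a fls \<Rightarrow> 'a fls" where
  "mobius a b c d z = (emb_poly a * z + emb_poly b) / (emb_poly c * z + emb_poly d)"

lemma congruence_class_eq:
  "congruence_class \<alpha> = {mobius a b c d \<alpha> | a b c d. a * d - b * c = 1}"
proof (intro subset_antisym subsetI)
  fix x assume "x \<in> congruence_class \<alpha>"
  then obtain G where "x = homography G \<alpha>" "det G = 1" by (auto simp: congruence_class_def)
  then show "x \<in> {mobius a b c d \<alpha> | a b c d. a * d - b * c = 1}"
    unfolding homography_def det_2 mobius_def by blast
next
  fix x assume "x \<in> {mobius a b c d \<alpha> | a b c d. a * d - b * c = 1}"
  then obtain a b c d where *: "x = mobius a b c d \<alpha>" "a * d - b * c = 1" by blast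
  define G :: "'a poly ^ 2 ^ 2" where "G = vector [vector [a, b], vector [c, d]]"
  have "det G = 1" "x = homography G \<alpha>"
    using * by (simp_all add: G_def det_2 homography_def mobius_def)
  then show "x \<in> congruence_class \<alpha>" by (auto simp: congruence_class_def)
qed

text \<open>The last two conditions are Vieta's relations for A Y^2 + B Y + C. Being symmetric in
  the roots, they let \<open>swap\<close> transfer every result to the conjugate.\<close>

locale quadratic_pair =
  fixes \<alpha> \<alpha>' :: "'a::{field,finite} fls" and A B C :: "'a poly"
  assumes irrational: "\<alpha> \<notin> rat_fls"
    and A_nonzero: "A \<noteq> 0"
    and trace: "emb_poly A * (\<alpha> + \<alpha>') = - emb_poly B"
    and norm: "emb_poly A * (\<alpha> * \<alpha>') = emb_poly C"
begin

lemma trace_rat: "\<alpha> + \<alpha>' \<in> rat_fls"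
proof -
  have "\<alpha> + \<alpha>' = - emb_poly B / emb_poly A" using trace A_nonzero by (simp add: field_simps)
  then show ?thesis by (simp only: rat_fls_intros)
qed

lemma norm_rat: "\<alpha> * \<alpha>' \<in> rat_fls"
proof -
  have "\<alpha> * \<alpha>' = emb_poly C / emb_poly A" using norm A_nonzero by (simp add: field_simps)
  then show ?thesis by (simp only: rat_fls_intros)
qed

lemma swap: "quadratic_pair \<alpha>' \<alpha> A B C"
proof
  show "\<alpha>' \<notin> rat_fls" using irrational rat_fls_diff[OF trace_rat, of \<alpha>'] by auto
qed (use A_nonzero trace norm in \<open>simp_all add: ac_simps\<close>)

lemma equation: "emb_poly A * \<alpha>\<^sup>2 + emb_poly B * \<alpha> + emb_poly C = 0"
proof -
  have B: "emb_poly B = - (emb_poly A * (\<alpha> + \<alpha>'))" using trace by simp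
  show ?thesis unfolding B norm[symmetric] by (simp add: algebra_simps power2_eq_square)
qed

lemma conj: "galois_conj \<alpha> = \<alpha>'"
  by (rule galois_conj_eqI[OF irrational trace_rat norm_rat])

text \<open>This makes heights positive, as the inverse of 0 is 0. If the roots agree, the trace is
  2 \<alpha> and the norm is \<alpha>^2: outside characteristic two the first makes \<alpha>
  rational, otherwise the second does by \<open>sqrt_rational_char_2\<close>.\<close>

lemma separable: "\<alpha> \<noteq> \<alpha>'"
proof
  assume eq: "\<alpha> = \<alpha>'"
  have two: "2 * \<alpha> \<in> rat_fls" using trace_rat unfolding eq[symmetric] by (simp only: mult_2)
  show False
  proof (cases "(2 :: 'a fls) = 0")
    case True
    then show ?thesis
      using norm_rat irrational sqrt_rational_char_2[of \<alpha>]
      unfolding eq[symmetric] power2_eq_square by blast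
  next
    case False
    have "2 * \<alpha> / (1 + 1) \<in> rat_fls" by (intro rat_fls_intros two)
    then show ?thesis using False irrational by (simp only: one_add_one) simp
  qed
qed

lemma linear_eq_0: "emb_poly u * \<alpha> + emb_poly v = 0 \<longleftrightarrow> u = 0 \<and> v = 0"
proof
  assume eq: "emb_poly u * \<alpha> + emb_poly v = 0"
  show "u = 0 \<and> v = 0"
  proof (cases "u = 0")
    case False
    with eq have "\<alpha> = - emb_poly v / emb_poly u" by (simp add: field_simps add_eq_0_iff2)
    also have "\<dots> \<in> rat_fls" by (intro rat_fls_intros)
    finally show ?thesis using irrational by simp
  qed (use eq in simp)
qed simp

lemma denom_nonzero:
  assumes "a * d - b * c = 1"
  shows "emb_poly c * \<alpha> + emb_poly d \<noteq> 0"
  using assms by (auto simp: linear_eq_0)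

text \<open>Over the common denominator the numerator is the determinant times \<alpha> -
  \<alpha>'.\<close>

lemma mobius_diff_conj:
  assumes "a * d - b * c = 1"
  shows "mobius a b c d \<alpha> - mobius a b c d \<alpha>' =
    (\<alpha> - \<alpha>') / ((emb_poly c * \<alpha> + emb_poly d) * (emb_poly c * \<alpha>' + emb_poly d))"
proof -
  interpret s: quadratic_pair \<alpha>' \<alpha> A B C by (rule swap)
  have "emb_poly a * emb_poly d - emb_poly b * emb_poly c = 1"
    using assms by (metis emb_poly_1 emb_poly_diff emb_poly_mult)
  then have 1: "emb_poly a * emb_poly d = 1 + emb_poly b * emb_poly c" by (simp add: algebra_simps)
  have "(emb_poly a * \<alpha> + emb_poly b) * (emb_poly c * \<alpha>' + emb_poly d) -
     (emb_poly a * \<alpha>' + emb_poly b) * (emb_poly c * \<alpha> + emb_poly d)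
     = (emb_poly a * emb_poly d - emb_poly b * emb_poly c) * (\<alpha> - \<alpha>')"
    by (simp add: algebra_simps)
  also have "\<dots> = \<alpha> - \<alpha>'" using 1 by simp
  finally have eq: "(emb_poly a * \<alpha> + emb_poly b) * (emb_poly c * \<alpha>' + emb_poly d) -
     (emb_poly a * \<alpha>' + emb_poly b) * (emb_poly c * \<alpha> + emb_poly d) = \<alpha> - \<alpha>'" .
  show ?thesis
    unfolding mobius_def diff_frac_eq[OF denom_nonzero[OF assms] s.denom_nonzero[OF assms]] eq ..
qed

text \<open>A rational image z could be transported back by solving for \<alpha>. That linear
  equation degenerates only if (a, b) = z (c, d), which would make the determinant 0.\<close>

lemma mobius_irrational:
  assumes "a * d - b * c = 1"
  shows "mobius a b c d \<alpha> \<notin> rat_fls"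
proof
  assume r: "mobius a b c d \<alpha> \<in> rat_fls"
  define z where "z = mobius a b c d \<alpha>"
  have "z * (emb_poly c * \<alpha> + emb_poly d) = emb_poly a * \<alpha> + emb_poly b"
    using denom_nonzero[OF assms] by (simp add: z_def mobius_def)
  then have eq: "\<alpha> * (z * emb_poly c - emb_poly a) = emb_poly b - z * emb_poly d"
    by (simp add: algebra_simps)
  have 1: "emb_poly a * emb_poly d - emb_poly b * emb_poly c = 1"
    using assms by (metis emb_poly_1 emb_poly_diff emb_poly_mult)
  show False
  proof (cases "z * emb_poly c - emb_poly a = 0")
    case True
    then have "emb_poly a = z * emb_poly c" "emb_poly b = z * emb_poly d" using eq by simp_all
    with 1 show False by (simp add: algebra_simps)
  next
    case False
    then have "\<alpha> = (emb_poly b - z * emb_poly d) / (z * emb_poly c - emb_poly a)"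
      using eq by (simp add: field_simps)
    also have "\<dots> \<in> rat_fls" using r by (auto simp: z_def intro!: rat_fls_intros)
    finally show False using irrational by simp
  qed
qed

text \<open>Sum and product of the two images are symmetric in \<alpha> and \<alpha>', hence
  rational expressions in trace and norm.\<close>

lemma conj_mobius:
  assumes "a * d - b * c = 1"
  shows "galois_conj (mobius a b c d \<alpha>) = mobius a b c d \<alpha>'"
proof (rule galois_conj_eqI)
  interpret s: quadratic_pair \<alpha>' \<alpha> A B C by (rule swap)
  define a' b' c' d' where abcd: "a' = emb_poly a" "b' = emb_poly b" "c' = emb_poly c" "d' = emb_poly d"
  note nz = denom_nonzero[OF assms, folded abcd] s.denom_nonzero[OF assms, folded abcd]
  have rat: "a' \<in> rat_fls" "b' \<in> rat_fls" "c' \<in> rat_fls" "d' \<in> rat_fls" by (simp_all add: abcd)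
  have den: "(c' * \<alpha> + d') * (c' * \<alpha>' + d') = c' * c' * (\<alpha> * \<alpha>') + c' * d' * (\<alpha> + \<alpha>') + d' * d'"
    by (simp add: algebra_simps)
  \<comment> \<open>Terms are repeated instead of multiplied by 2, so that the closure rules of
    \<open>rat_fls\<close> apply literally.\<close>
  have "mobius a b c d \<alpha> + mobius a b c d \<alpha>' =
    ((a' * c' * (\<alpha> * \<alpha>') + a' * c' * (\<alpha> * \<alpha>') + (a' * d' + b' * c') * (\<alpha> + \<alpha>') + b' * d' + b' * d')) /
    (c' * c' * (\<alpha> * \<alpha>') + c' * d' * (\<alpha> + \<alpha>') + d' * d')"
    unfolding den[symmetric] mobius_def abcd[symmetric] using nz
    by (simp add: add_frac_eq) (simp add: algebra_simps)
  also have "\<dots> \<in> rat_fls" by (intro rat_fls_intros rat trace_rat norm_rat)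
  finally show "mobius a b c d \<alpha> + mobius a b c d \<alpha>' \<in> rat_fls" .
  have "mobius a b c d \<alpha> * mobius a b c d \<alpha>' =
    (a' * a' * (\<alpha> * \<alpha>') + a' * b' * (\<alpha> + \<alpha>') + b' * b') /
    (c' * c' * (\<alpha> * \<alpha>') + c' * d' * (\<alpha> + \<alpha>') + d' * d')"
    unfolding den[symmetric] mobius_def abcd[symmetric] using nz
    by (simp add: algebra_simps)
  also have "\<dots> \<in> rat_fls" by (intro rat_fls_intros rat trace_rat norm_rat)
  finally show "mobius a b c d \<alpha> * mobius a b c d \<alpha>' \<in> rat_fls" .
qed (rule mobius_irrational[OF assms])

text \<open>A consequence of \<open>mobius_diff_conj\<close>; the factor is the absolute value of
  the norm of c \<alpha> + d.\<close>

lemma height_mobius: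
  assumes "a * d - b * c = 1"
  shows "height (mobius a b c d \<alpha>) =
    abs_inf (emb_poly c * \<alpha> + emb_poly d) * abs_inf (emb_poly c * \<alpha>' + emb_poly d) * height \<alpha>"
  by (simp add: height_def conj_mobius[OF assms] mobius_diff_conj[OF assms] conj abs_inf_divide
      abs_inf_mult abs_inf_inverse divide_inverse)

text \<open>Modulo A Y^2 + B Y + C the form becomes linear, and its norm is a nonzero polynomial up
  to powers of A. Two factors A come from the two reductions, the third from clearing the
  denominator of the norm.\<close>

lemma norm_form_lower_bound:
  assumes "emb_poly u * \<alpha>\<^sup>2 + emb_poly v * \<alpha> + emb_poly w \<noteq> 0"
  shows "abs_inf (emb_poly u * \<alpha>\<^sup>2 + emb_poly v * \<alpha> + emb_poly w) *
    abs_inf (emb_poly u * \<alpha>'\<^sup>2 + emb_poly v * \<alpha>' + emb_poly w) \<ge> 1 / abs_inf (emb_poly A) ^ 3"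
proof -
  interpret s: quadratic_pair \<alpha>' \<alpha> A B C by (rule swap)
  \<comment> \<open>The remainder U Y + V is A (u Y^2 + v Y + w) minus u (A Y^2 + B Y + C).\<close>
  define U V where UV: "U = v * A - u * B" "V = w * A - u * C"
  have red: "emb_poly A * (emb_poly u * z\<^sup>2 + emb_poly v * z + emb_poly w) = emb_poly U * z + emb_poly V"
    if "emb_poly A * z\<^sup>2 + emb_poly B * z + emb_poly C = 0" for z
  proof -
    have "emb_poly A * (emb_poly u * z\<^sup>2 + emb_poly v * z + emb_poly w) - (emb_poly U * z + emb_poly V)
      = emb_poly u * (emb_poly A * z\<^sup>2 + emb_poly B * z + emb_poly C)"
      by (simp add: UV emb_poly_simps algebra_simps)
    then show ?thesis using that by simp
  qed
  define N where "N = U * U * C - U * V * B + V * V * A"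
  have "emb_poly A * ((emb_poly U * \<alpha> + emb_poly V) * (emb_poly U * \<alpha>' + emb_poly V)) =
    emb_poly U * emb_poly U * (emb_poly A * (\<alpha> * \<alpha>')) + emb_poly U * emb_poly V * (emb_poly A * (\<alpha> + \<alpha>'))
    + emb_poly V * emb_poly V * emb_poly A"
    by (simp add: algebra_simps)
  also have "\<dots> = emb_poly N" unfolding norm trace by (simp add: N_def emb_poly_simps)
  finally have N: "emb_poly N = emb_poly A * ((emb_poly U * \<alpha> + emb_poly V) * (emb_poly U * \<alpha>' + emb_poly V))" ..
  have "emb_poly U * \<alpha> + emb_poly V \<noteq> 0"
    using assms red[OF equation] A_nonzero by (metis emb_poly_eq_0_iff mult_eq_0_iff)
  then have "N \<noteq> 0"
    using N A_nonzero s.linear_eq_0 linear_eq_0 by (metis emb_poly_eq_0_iff mult_eq_0_iff)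
  then have "1 \<le> abs_inf (emb_poly N)" by (rule abs_inf_emb_poly_ge_1)
  also have "\<dots> = abs_inf (emb_poly A) ^ 3 * (abs_inf (emb_poly u * \<alpha>\<^sup>2 + emb_poly v * \<alpha> + emb_poly w) *
    abs_inf (emb_poly u * \<alpha>'\<^sup>2 + emb_poly v * \<alpha>' + emb_poly w))"
    unfolding N red[OF equation, symmetric] red[OF s.equation, symmetric] abs_inf_mult
    by (simp add: power3_eq_cube)
  finally show ?thesis
    using A_nonzero by (simp add: divide_le_eq mult.commute)
qed

text \<open>As a function of z the difference of the images is a quadratic polynomial over the
  product of the denominators. Multiplying the values at \<alpha> and \<alpha>' gives a norm form in
  the numerator, while the denominators combine to the heights by
  \<open>height_mobius\<close>.\<close>

lemma mobius_diff_product: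
  assumes 1: "a * d - b * c = 1" and 2: "a' * d' - b' * c' = 1"
    and neq: "mobius a b c d \<alpha> \<noteq> mobius a' b' c' d' \<alpha>"
  shows "abs_inf (mobius a b c d \<alpha> - mobius a' b' c' d' \<alpha>) *
    abs_inf (mobius a b c d \<alpha>' - mobius a' b' c' d' \<alpha>') \<ge>
    (height \<alpha>)\<^sup>2 / abs_inf (emb_poly A) ^ 3 / (height (mobius a b c d \<alpha>) * height (mobius a' b' c' d' \<alpha>))"
proof -
  interpret s: quadratic_pair \<alpha>' \<alpha> A B C by (rule swap)
  define u v w where uvw: "u = a * c' - a' * c" "v = a * d' + b * c' - a' * d - b' * c" "w = b * d' - b' * d"
  have eq: "mobius a b c d z - mobius a' b' c' d' z = (emb_poly u * z\<^sup>2 + emb_poly v * z + emb_poly w) /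
      ((emb_poly c * z + emb_poly d) * (emb_poly c' * z + emb_poly d'))"
    if "emb_poly c * z + emb_poly d \<noteq> 0" "emb_poly c' * z + emb_poly d' \<noteq> 0" for z
    using that unfolding mobius_def
    by (simp add: diff_frac_eq) (simp add: uvw emb_poly_simps algebra_simps power2_eq_square)
  note nz = denom_nonzero[OF 1] denom_nonzero[OF 2] s.denom_nonzero[OF 1] s.denom_nonzero[OF 2]
  have "emb_poly u * \<alpha>\<^sup>2 + emb_poly v * \<alpha> + emb_poly w \<noteq> 0"
    using neq eq[of \<alpha>] nz by auto
  then have "1 / abs_inf (emb_poly A) ^ 3 \<le> abs_inf (emb_poly u * \<alpha>\<^sup>2 + emb_poly v * \<alpha> + emb_poly w) *
    abs_inf (emb_poly u * \<alpha>'\<^sup>2 + emb_poly v * \<alpha>' + emb_poly w)"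
    by (rule norm_form_lower_bound)
  moreover have "height \<alpha> > 0" using separable by (simp add: height_def conj)
  ultimately show ?thesis
    using nz A_nonzero
    by (simp add: eq height_mobius[OF 1] height_mobius[OF 2] abs_inf_divide abs_inf_mult
        divide_simps power2_eq_square mult_ac)
qed

lemma height_pos:
  assumes "\<beta> \<in> congruence_class \<alpha>"
  shows "height \<beta> > 0"
proof -
  interpret s: quadratic_pair \<alpha>' \<alpha> A B C by (rule swap)
  have "height \<alpha> > 0" using separable by (simp add: height_def conj)
  with assms show ?thesis
    by (auto simp: congruence_class_eq height_mobius denom_nonzero s.denom_nonzero)
qed

text \<open>\<open>mobius_diff_product\<close> controls only the product with the distance of the
  conjugates. If \<beta> and \<beta>' are closer than 1 / height \<beta>', however, the conjugates
  are within 1 / height \<beta> of each other, and dividing by this leaves the bound for \<beta> and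
  \<beta>' alone.\<close>

theorem separation:
  obtains \<kappa> where "\<kappa> > 0"
    "\<And>\<beta> \<beta>'. \<beta> \<in> congruence_class \<alpha> \<Longrightarrow> \<beta>' \<in> congruence_class \<alpha> \<Longrightarrow> \<beta> \<noteq> \<beta>' \<Longrightarrow>
      height \<beta> \<le> height \<beta>' \<Longrightarrow> abs_inf (\<beta> - \<beta>') \<ge> \<kappa> / height \<beta>'"
proof -
  \<comment> \<open>The minimum with 1 serves the case in which the distance is at least 1 / height
    \<beta>'.\<close>
  define \<kappa> where "\<kappa> = min 1 ((height \<alpha>)\<^sup>2 / abs_inf (emb_poly A) ^ 3)"
  have h\<alpha>: "height \<alpha> > 0" using separable by (simp add: height_def conj)
  show ?thesis
  proof (rule that)
    show "\<kappa> > 0" using h\<alpha> A_nonzero by (simp add: \<kappa>_def)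
    fix \<beta> \<beta>' assume mem: "\<beta> \<in> congruence_class \<alpha>" "\<beta>' \<in> congruence_class \<alpha>"
      and neq: "\<beta> \<noteq> \<beta>'" and le: "height \<beta> \<le> height \<beta>'"
    obtain a b c d where \<beta>: "\<beta> = mobius a b c d \<alpha>" "a * d - b * c = 1"
      using mem(1) by (auto simp: congruence_class_eq)
    obtain a' b' c' d' where \<beta>': "\<beta>' = mobius a' b' c' d' \<alpha>" "a' * d' - b' * c' = 1"
      using mem(2) by (auto simp: congruence_class_eq)
    define \<gamma> \<gamma>' where \<gamma>: "\<gamma> = galois_conj \<beta>" "\<gamma>' = galois_conj \<beta>'"
    have pos: "height \<beta> > 0" "height \<beta>' > 0" using mem by (auto intro: height_pos)
    have prod: "\<kappa> / (height \<beta> * height \<beta>') \<le> abs_inf (\<beta> - \<beta>') * abs_inf (\<gamma> - \<gamma>')"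
    proof -
      have "\<kappa> / (height \<beta> * height \<beta>') \<le> (height \<alpha>)\<^sup>2 / abs_inf (emb_poly A) ^ 3 / (height \<beta> * height \<beta>')"
        using pos by (intro divide_right_mono) (auto simp: \<kappa>_def)
      also have "\<dots> \<le> abs_inf (\<beta> - \<beta>') * abs_inf (\<gamma> - \<gamma>')"
        using mobius_diff_product[OF \<beta>(2) \<beta>'(2)] neq
        by (simp add: \<gamma> \<beta>(1) \<beta>'(1) conj_mobius[OF \<beta>(2)] conj_mobius[OF \<beta>'(2)])
      finally show ?thesis .
    qed
    have hb: "abs_inf (\<beta> - \<gamma>) = 1 / height \<beta>" "abs_inf (\<beta>' - \<gamma>') = 1 / height \<beta>'"
      by (simp_all add: height_def \<gamma> inverse_eq_divide)
    show "abs_inf (\<beta> - \<beta>') \<ge> \<kappa> / height \<beta>'"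
    proof (cases "abs_inf (\<beta> - \<beta>') \<ge> 1 / height \<beta>'")
      case True
      moreover have "\<kappa> / height \<beta>' \<le> 1 / height \<beta>'"
        using pos by (intro divide_right_mono) (auto simp: \<kappa>_def)
      ultimately show ?thesis by linarith
    next
      case False
      have le': "1 / height \<beta>' \<le> 1 / height \<beta>" using le pos by (simp add: field_simps)
      \<comment> \<open>The path from \<gamma> to \<gamma>' runs through \<beta> and \<beta>'; its
        first leg dominates because \<beta> has the smaller height.\<close>
      have "abs_inf (\<gamma> - \<gamma>') \<le> max (abs_inf (\<gamma> - \<beta>)) (max (abs_inf (\<beta> - \<beta>')) (abs_inf (\<beta>' - \<gamma>')))"
        using abs_inf_triangle[of \<gamma> \<gamma>' \<beta>] abs_inf_triangle[of \<beta> \<gamma>' \<beta>'] by linarith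
      also have "\<dots> \<le> 1 / height \<beta>"
        using hb le' False by (simp add: abs_inf_diff_commute[of \<gamma> \<beta>])
      finally have "abs_inf (\<beta> - \<beta>') * abs_inf (\<gamma> - \<gamma>') \<le> abs_inf (\<beta> - \<beta>') * (1 / height \<beta>)"
        by (intro mult_left_mono) auto
      with prod have "\<kappa> / (height \<beta> * height \<beta>') \<le> abs_inf (\<beta> - \<beta>') * (1 / height \<beta>)" by linarith
      then show ?thesis using pos by (simp add: field_simps)
    qed
  qed
qed

end

lemma quad_irr_pair:
  assumes "\<alpha> \<in> quad_irr"
  obtains A B C where "quadratic_pair \<alpha> (galois_conj \<alpha>) A B C"
proof -
  obtain A B C where *: "\<alpha> \<notin> rat_fls" "A \<noteq> 0" "emb_poly A * \<alpha>\<^sup>2 + emb_poly B * \<alpha> + emb_poly C = 0"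
    using assms by (rule quad_irrE)
  define \<beta> where "\<beta> = - emb_poly B / emb_poly A - \<alpha>"
  have tr: "emb_poly A * (\<alpha> + \<beta>) = - emb_poly B" using *(2) by (simp add: \<beta>_def)
  have "emb_poly A * (\<alpha> * \<beta>) = \<alpha> * (emb_poly A * (\<alpha> + \<beta>)) - emb_poly A * \<alpha>\<^sup>2"
    by (simp add: algebra_simps power2_eq_square)
  also have "\<dots> = emb_poly C - (emb_poly A * \<alpha>\<^sup>2 + emb_poly B * \<alpha> + emb_poly C)" 
    unfolding tr by simp
  finally have no: "emb_poly A * (\<alpha> * \<beta>) = emb_poly C" using *(3) by simp
  have "quadratic_pair \<alpha> \<beta> A B C" using * tr no by unfold_locales
  moreover from this have "galois_conj \<alpha> = \<beta>" by (rule quadratic_pair.conj)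
  ultimately show ?thesis using that by metis
qed

subsection \<open>Balls and Haar measure\<close>

text \<open>These are the closed balls of radius q^(-k). The description by coefficients makes
  nesting and disjointness immediate, and serves both \<open>abs_inf\<close> and the library metric,
  whose base is 2.\<close>

definition cyl :: "int \<Rightarrow> 'a::zero fls \<Rightarrow> 'a fls set" where
  "cyl k x = {y. \<forall>i<k. fls_nth y i = fls_nth x i}"

lemma cyl_self [simp]: "x \<in> cyl k x"
  by (simp add: cyl_def)

lemma cyl_sym: "y \<in> cyl k x \<longleftrightarrow> x \<in> cyl k y"
  by (auto simp: cyl_def)

lemma cyl_eq: "y \<in> cyl k x \<Longrightarrow> cyl k y = cyl k x"
  by (auto simp: cyl_def)

lemma cyl_mono: "k \<le> k' \<Longrightarrow> cyl k' x \<subseteq> cyl k x"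
  by (auto simp: cyl_def)

lemma cyl_subset: "y \<in> cyl k x \<Longrightarrow> k \<le> k' \<Longrightarrow> cyl k' y \<subseteq> cyl k x"
  using cyl_eq cyl_mono by blast

lemma cyl_disjoint: "y \<notin> cyl k x \<Longrightarrow> cyl k x \<inter> cyl k y = {}"
  by (auto simp: cyl_def)

lemma cyl_translate: "cyl k x = (+) x ` cyl k (0 :: 'a::group_add fls)"
proof
  show "cyl k x \<subseteq> (+) x ` cyl k 0"
  proof
    fix y assume "y \<in> cyl k x"
    then have "- x + y \<in> cyl k 0" by (simp add: cyl_def)
    then show "y \<in> (+) x ` cyl k 0" by (rule rev_image_eqI) simp
  qed
qed (auto simp: cyl_def)

lemma cyl_iff_abs_inf:
  "y \<in> cyl k x \<longleftrightarrow> abs_inf (x - y) \<le> real CARD('a) powi (- k)"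
  for x y :: "'a::{field,finite} fls"
  unfolding abs_inf_le_iff by (auto simp: cyl_def)

lemma UN_cyl: "(\<Union>n. cyl (- int n) (0 :: 'a::zero fls)) = UNIV"
proof -
  have "x \<in> cyl (- int (nat (- fls_subdegree x))) 0" for x :: "'a fls"
    by (auto simp: cyl_def)
  then show ?thesis by blast
qed

lemma dist_fls_le_iff: "dist x y \<le> 2 powi (- k) \<longleftrightarrow> y \<in> cyl k (x :: 'a::group_add fls)"
proof (cases "x = y")
  case False
  have "dist x y = 2 powi (- fls_subdegree (x - y))"
    using False by (auto simp: dist_fls_def power_int_def power_one_over inverse_eq_divide)
  then have "dist x y \<le> 2 powi (- k) \<longleftrightarrow> k \<le> fls_subdegree (x - y)"
    by (simp add: powi_le_iff)
  also have "\<dots> \<longleftrightarrow> (\<forall>i<k. fls_nth (x - y) i = 0)"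
    using False fls_subdegree_geI[of "x - y" k] fls_eq0_below_subdegree[of _ "x - y"] by fastforce
  finally show ?thesis by (auto simp: cyl_def)
qed simp

lemma exists_powi_less:
  assumes "1 < (q :: real)" "e > 0"
  shows "\<exists>n::nat. q powi (- int n) < e"
proof -
  obtain n where "inverse q ^ n < e"
    using real_arch_pow_inv[of e "inverse q"] assms by (auto simp: field_simps)
  then show ?thesis by (auto simp: power_int_minus power_inverse)
qed

text \<open>Rounds a radius down to a power of q, the only radii at which the balls
  \<open>cyl\<close> exist.\<close>

lemma exists_powi_bracket:
  assumes "1 < (q :: real)" "e > 0"
  obtains i where "q powi (- i) \<le> e" "e < q * q powi (- i)"
proof
  define i where "i = - \<lfloor>log q e\<rfloor>"
  have "q powi (- i) = q powr of_int \<lfloor>log q e\<rfloor>"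
    using assms by (simp add: i_def powr_real_of_int')
  also have "\<dots> \<le> q powr (log q e)" using assms by (intro powr_mono) auto
  finally show "q powi (- i) \<le> e" using assms by simp
  have "e = q powr (log q e)" using assms by simp
  also have "\<dots> < q powr (1 + of_int \<lfloor>log q e\<rfloor>)" using assms by (intro powr_less_mono) linarith+
  also have "\<dots> = q * q powi (- i)"
    using assms by (simp add: i_def powr_add powr_real_of_int')
  finally show "e < q * q powi (- i)" .
qed

lemma open_cyl [simp]: "open (cyl k (x :: 'a::group_add fls))"
  unfolding open_dist
proof (intro ballI exI conjI allI impI)
  fix y z assume "y \<in> cyl k x" "dist z y < 2 powi (- k)"
  then show "z \<in> cyl k x"
    using dist_fls_le_iff[of y z k] cyl_subset[of y k x k] by (auto simp: dist_commute)
qed simp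

lemma open_contains_cyl:
  assumes "open U" "x \<in> U"
  obtains n :: nat where "cyl (int n) (x :: 'a::group_add fls) \<subseteq> U"
proof -
  obtain e where e: "e > 0" "ball x e \<subseteq> U" using assms openE by blast
  obtain n :: nat where n: "2 powi (- int n) < e" using exists_powi_less[of 2 e] e by auto
  have "cyl (int n) x \<subseteq> ball x e"
    using n by (auto simp: ball_def dist_fls_le_iff[symmetric])
  with e that show ?thesis by blast
qed

text \<open>The pieces correspond to the free choices of the coefficients at the positions k, ...,
  k' - 1.\<close>

lemma cyl_partition:
  fixes x :: "'a::{field,finite} fls"
  assumes "k \<le> k'"
  obtains K where "finite K" "card K = CARD('a) ^ nat (k' - k)" "K \<subseteq> cyl k x"
    "cyl k x = (\<Union>z\<in>K. cyl k' z)" "disjoint_family_on (cyl k') K"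
proof -
  let ?G = "{k..<k'} \<rightarrow>\<^sub>E (UNIV :: 'a set)"
  define w where "w g = Abs_fls (\<lambda>i. if k \<le> i \<and> i < k' then g i else fls_nth x i)" for g
  have w_nth: "fls_nth (w g) i = (if k \<le> i \<and> i < k' then g i else fls_nth x i)" for g i
    unfolding w_def
    by (subst nth_Abs_fls_lower_bound[where N = "min k (fls_subdegree x)"]) auto
  have inj: "g = g'" if "g \<in> ?G" "g' \<in> ?G" "\<And>i. i < k' \<Longrightarrow> fls_nth (w g) i = fls_nth (w g') i" for g g'
  proof (rule PiE_ext[OF that(1,2)])
    fix i assume "i \<in> {k..<k'}"
    with that(3)[of i] show "g i = g' i" by (simp add: w_nth)
  qed
  show ?thesis
  proof (rule that)
    show "finite (w ` ?G)" by (intro finite_imageI finite_PiE) auto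
    have "inj_on w ?G" by (rule inj_onI) (auto intro: inj)
    then show "card (w ` ?G) = CARD('a) ^ nat (k' - k)"
      by (simp add: card_image card_PiE)
    show "w ` ?G \<subseteq> cyl k x" by (auto simp: cyl_def w_nth)
    show "disjoint_family_on (cyl k') (w ` ?G)"
      unfolding disjoint_family_on_def
    proof (intro ballI impI)
      fix y z assume "y \<in> w ` ?G" "z \<in> w ` ?G" "y \<noteq> z"
      then obtain g g' where "y = w g" "z = w g'" "g \<in> ?G" "g' \<in> ?G" "g \<noteq> g'" by blast
      then have "z \<notin> cyl k' y" using inj[of g g'] by (auto simp: cyl_def)
      then show "cyl k' y \<inter> cyl k' z = {}" by (rule cyl_disjoint)
    qed
    show "cyl k x = (\<Union>z\<in>w ` ?G. cyl k' z)"
    proof (intro subset_antisym subsetI)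
      fix y assume y: "y \<in> cyl k x"
      have "y \<in> cyl k' (w (restrict (fls_nth y) {k..<k'}))"
        using y by (auto simp: cyl_def w_nth)
      moreover have "restrict (fls_nth y) {k..<k'} \<in> ?G" by simp
      ultimately show "y \<in> (\<Union>z\<in>w ` ?G. cyl k' z)" by (intro UN_I[of "w (restrict (fls_nth y) {k..<k'})"] imageI)
    next
      fix y assume "y \<in> (\<Union>z\<in>w ` ?G. cyl k' z)"
      then show "y \<in> cyl k x" using assms by (auto simp: cyl_def w_nth)
    qed
  qed
qed

text \<open>Pigeonhole: separated points fall into different pieces of the partition into balls of
  index s.\<close>

lemma cyl_packing:
  fixes x :: "'a::{field,finite} fls"
  assumes "k \<le> s" "E \<subseteq> cyl k x" "\<And>y y'. y \<in> E \<Longrightarrow> y' \<in> E \<Longrightarrow> y \<noteq> y' \<Longrightarrow> y' \<notin> cyl s y"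
  shows "finite E" "real (card E) \<le> real CARD('a) powi (s - k)"
proof -
  obtain K where K: "finite K" "card K = CARD('a) ^ nat (s - k)" "cyl k x = (\<Union>z\<in>K. cyl s z)"
    using cyl_partition[OF assms(1)] by metis
  have "\<forall>y\<in>E. \<exists>z\<in>K. y \<in> cyl s z" using assms(2) K(3) by blast
  then obtain f where f: "\<And>y. y \<in> E \<Longrightarrow> f y \<in> K" "\<And>y. y \<in> E \<Longrightarrow> y \<in> cyl s (f y)" by metis
  have "inj_on f E"
  proof (rule inj_onI, rule ccontr)
    fix y y' assume *: "y \<in> E" "y' \<in> E" "f y = f y'" "y \<noteq> y'"
    then have "y' \<in> cyl s y" using f(2)[of y] f(2)[of y'] by (auto simp: cyl_def)
    with assms(3) * show False by blast
  qed
  moreover have "f ` E \<subseteq> K" using f by blast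
  ultimately show "finite E" and "real (card E) \<le> real CARD('a) powi (s - k)"
    using inj_on_finite[of f E K] card_inj_on_le[of f E K] K assms(1)
    by (auto simp: power_int_def)
qed

text \<open>The limit is formed coefficientwise. Membership in one ball fixes the coefficients below
  k, which keeps the limit a Laurent series.\<close>

lemma complete_cyl: "complete (cyl k (x :: 'a::group_add fls))"
  unfolding complete_def
proof (intro allI impI)
  fix f assume f: "(\<forall>n. f n \<in> cyl k x) \<and> Cauchy f"
  have "\<exists>N. \<forall>m\<ge>N. \<forall>n\<ge>N. f n \<in> cyl j (f m)" for j
  proof -
    obtain N where "\<And>m n. m \<ge> N \<Longrightarrow> n \<ge> N \<Longrightarrow> dist (f m) (f n) < 2 powi (- j)"
      using f metric_CauchyD[of f "2 powi (- j)"] by auto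
    then show ?thesis by (force simp: dist_fls_le_iff[symmetric] intro: less_imp_le)
  qed
  then obtain N where N: "\<And>j m n. m \<ge> N j \<Longrightarrow> n \<ge> N j \<Longrightarrow> f n \<in> cyl j (f m)" by metis
  \<comment> \<open>The shift to \<open>i + 1\<close> is there because \<open>cyl j\<close> fixes
    only the indices below j; from \<open>N (i + 1)\<close> on, the coefficient at i is constant
    along the sequence.\<close>
  define l where "l = Abs_fls (\<lambda>i. fls_nth (f (N (i + 1))) i)"
  have fx: "fls_nth (f n) i = fls_nth x i" if "i < k" for n i
    using f that by (auto simp: cyl_def)
  have l_nth: "fls_nth l i = fls_nth (f (N (i + 1))) i" for i
    unfolding l_def
    by (subst nth_Abs_fls_lower_bound[where N = "min k (fls_subdegree x)"]) (auto simp: fx)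
  have l: "f n \<in> cyl j l" if "n \<ge> N j" for n j
  proof -
    have "fls_nth (f n) i = fls_nth l i" if "i < j" for i
    proof -
      define m where "m = max n (N (i + 1))"
      have "f m \<in> cyl j (f n)" "f m \<in> cyl (i + 1) (f (N (i + 1)))"
        using \<open>n \<ge> N j\<close> by (auto intro!: N simp: m_def)
      then show ?thesis using that by (simp add: l_nth cyl_def)
    qed
    then show ?thesis by (simp add: cyl_def)
  qed
  have "f \<longlonglongrightarrow> l"
  proof (rule metric_LIMSEQ_I)
    fix e :: real assume "e > 0"
    then obtain n :: nat where n: "2 powi (- int n) < e" using exists_powi_less[of 2 e] by auto
    have "dist (f m) l < e" if "m \<ge> N (int n)" for m
      using l[OF that] n by (simp add: dist_fls_le_iff[symmetric] dist_commute)
    then show "\<exists>M. \<forall>m\<ge>M. dist (f m) l < e" by blast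
  qed
  moreover have "l \<in> cyl k x" by (simp add: cyl_def l_nth fx)
  ultimately show "\<exists>l\<in>cyl k x. f \<longlonglongrightarrow> l" by blast
qed

text \<open>Total boundedness is the finite partition into smaller balls; this is where finiteness
  of the coefficient field enters.\<close>

lemma compact_cyl: "compact (cyl k (x :: 'a::{field,finite} fls))"
  unfolding compact_eq_totally_bounded
proof (intro conjI complete_cyl allI impI)
  fix e :: real assume "e > 0"
  then obtain n :: nat where n: "2 powi (- int n) < e" using exists_powi_less[of 2 e] by auto
  obtain K where K: "finite K" "cyl k x = (\<Union>z\<in>K. cyl (max k (int n)) z)"
    using cyl_partition[of k "max k (int n)" x] by (metis max.cobounded1)
  have "cyl (max k (int n)) z \<subseteq> ball z e" for z :: "'a fls"
  proof
    fix y assume "y \<in> cyl (max k (int n)) z"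
    then have "y \<in> cyl (int n) z" using cyl_mono[of "int n" "max k (int n)" z] by auto
    then show "y \<in> ball z e" using n by (simp add: dist_fls_le_iff[symmetric])
  qed
  then have "cyl k x \<subseteq> (\<Union>z\<in>K. ball z e)" unfolding K(2) by (rule UN_mono[OF order_refl])
  with K(1) show "\<exists>K. finite K \<and> cyl k x \<subseteq> (\<Union>z\<in>K. ball z e)" by (intro exI conjI)
qed

text \<open>All that later arguments use of a Haar measure is the mass of each ball; M is the mass
  of the balls of radius 1.\<close>

locale haar_fls =
  fixes \<mu> :: "'a::{field,finite} fls measure" and M q :: real
  assumes sets_borel: "sets \<mu> = sets borel"
    and M_pos: "M > 0"
    and emeasure_cyl: "emeasure \<mu> (cyl k x) = ennreal (M * q powi (- k))"
    and q_def: "q = real CARD('a)"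
begin

lemma q_gt_1: "q > 1"
  using card_field_gt_1[where 'a = 'a] by (simp add: q_def)

lemma q_ge_2: "q \<ge> 2"
proof -
  have "CARD('a) \<ge> 2" using q_gt_1 unfolding q_def by linarith
  then show ?thesis by (simp add: q_def)
qed

lemma cyl_sets [measurable, simp]: "cyl k x \<in> sets \<mu>"
  by (simp add: sets_borel borel_open)

lemma cyl_fmeasurable [simp]: "cyl k x \<in> fmeasurable \<mu>"
  by (intro fmeasurableI) (simp_all add: emeasure_cyl)

lemma measure_cyl: "measure \<mu> (cyl k x) = M * q powi (- k)"
  using M_pos q_gt_1 by (simp add: measure_def emeasure_cyl)

lemma AE_of_null_in_cyl:
  assumes "{x. P x} \<in> sets \<mu>" "\<And>n. emeasure \<mu> (cyl (- int n) 0 - {x. P x}) = 0"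
  shows "AE x in \<mu>. P x"
proof (rule AE_I')
  show "(\<Union>n. cyl (- int n) 0 - {x. P x}) \<in> null_sets \<mu>"
    using assms by (intro null_sets_UN) (auto simp: null_sets_def)
  show "{x \<in> space \<mu>. \<not> P x} \<subseteq> (\<Union>n. cyl (- int n) 0 - {x. P x})"
    using UN_cyl[where 'a = 'a] by blast
qed

end

text \<open>By invariance the mass of a ball depends on its radius only, and the partition into
  translates fixes this dependence. It is finite by compactness, and positive because otherwise
  countably many null balls would cover the field.\<close>

lemma haar_measure_haar_fls:
  fixes \<mu> :: "'a::{field,finite} fls measure"
  assumes "haar_measure \<mu>"
  obtains M where "haar_fls \<mu> M (real CARD('a))"
proof -
  let ?q = "real CARD('a)"
  have sets: "sets \<mu> = sets borel" and fin: "\<And>C. compact C \<Longrightarrow> emeasure \<mu> C < \<infinity>"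
    and nz: "emeasure \<mu> UNIV \<noteq> 0"
    and inv: "\<And>a A. A \<in> sets borel \<Longrightarrow> emeasure \<mu> ((+) a ` A) = emeasure \<mu> A"
    using assms by (auto simp: haar_measure_def)
  have meas: "cyl k x \<in> sets \<mu>" for k and x :: "'a fls" by (simp add: sets borel_open)
  define m where "m k = measure \<mu> (cyl k 0)" for k
  have em: "emeasure \<mu> (cyl k x) = ennreal (m k)" for k x
    using inv[of "cyl k 0" x] fin[OF compact_cyl, of k 0] cyl_translate[of k x]
    by (simp add: m_def emeasure_eq_ennreal_measure borel_open less_top)
  have scale: "m k = ?q powi (k' - k) * m k'" if kk: "k \<le> k'" for k k'
  proof -
    obtain K :: "'a fls set" where K: "finite K" "card K = CARD('a) ^ nat (k' - k)"
      "cyl k 0 = (\<Union>z\<in>K. cyl k' z)" "disjoint_family_on (cyl k') K"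
      by (rule cyl_partition[OF kk])
    have "ennreal (m k) = (\<Sum>z\<in>K. emeasure \<mu> (cyl k' z))"
      unfolding em[of k 0, symmetric] K(3) using K meas by (intro sum_emeasure[symmetric]) auto
    also have "\<dots> = ennreal (real (card K) * m k')"
      by (simp add: em ennreal_mult ennreal_of_nat_eq_real_of_nat m_def)
    finally show ?thesis using K(2) that by (simp add: m_def power_int_def)
  qed
  have mk: "m k = m 0 * ?q powi (- k)" for k
    using scale[of k 0] scale[of 0 k] card_field_gt_1[where 'a='a]
    by (cases "k \<le> 0") (auto simp: power_int_minus field_simps)
  have "m 0 > 0"
  proof (rule ccontr)
    assume "\<not> m 0 > 0"
    then have "m 0 = 0" using measure_nonneg[of \<mu> "cyl 0 0"] unfolding m_def by linarith
    then have "emeasure \<mu> (cyl k x) = 0" for k x using mk[of k] by (simp add: em)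
    then have "emeasure \<mu> (\<Union>n. cyl (- int n) 0) = 0"
      using meas by (intro emeasure_UN_eq_0) auto
    with nz show False by (simp add: UN_cyl)
  qed
  moreover have "emeasure \<mu> (cyl k x) = ennreal (m 0 * ?q powi (- k))" for k x
    unfolding em mk[of k] ..
  ultimately have "haar_fls \<mu> (m 0) ?q"
    using sets by (intro haar_fls.intro) simp_all
  then show ?thesis by (rule that)
qed

subsection \<open>Limsup sets of unions of small balls\<close>

context haar_fls
begin

lemma powi_pos [simp]: "q powi a > 0"
  using q_gt_1 by simp

lemma powi_add: "q powi (a + b) = q powi a * q powi b"
  using q_gt_1 by (simp add: power_int_add)

lemma sets_UN_cyl [simp]: "(\<Union>x\<in>E. cyl (r x) x) \<in> sets \<mu>"
  unfolding sets_borel by (intro borel_open open_UN) auto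

lemma measure_UN_cyl_le:
  assumes "finite E"
  shows "measure \<mu> (\<Union>x\<in>E. cyl r x) \<le> real (card E) * (M * q powi (- r))"
  using measure_UNION_le[OF assms, of "cyl r" \<mu>] by (simp add: measure_cyl)

lemma packing:
  fixes x :: "'a fls"
  assumes "k \<le> s" "E \<subseteq> cyl k x" "\<And>y y'. y \<in> E \<Longrightarrow> y' \<in> E \<Longrightarrow> y \<noteq> y' \<Longrightarrow> y' \<notin> cyl s y"
  shows "finite E" "real (card E) \<le> q powi (s - k)"
  using cyl_packing[OF assms] by (simp_all add: q_def)

text \<open>By separation a fixed ball contains O(q^n) points of \<open>S n\<close>, so the targets
  of index n cover mass O(q^(n - \<rho> n)) in it. The first Borel--Cantelli lemma applies in each
  ball, and countably many balls exhaust the field.\<close>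

lemma AE_eventually_avoids:
  fixes S :: "nat \<Rightarrow> 'a fls set"
  assumes sep: "\<And>n \<beta> \<beta>'. \<beta> \<in> S n \<Longrightarrow> \<beta>' \<in> S n \<Longrightarrow> \<beta> \<noteq> \<beta>' \<Longrightarrow> \<beta>' \<notin> cyl (int n + j) \<beta>"
    and summable: "summable (\<lambda>n. q powi (int n - \<rho> n))"
  shows "AE x in \<mu>. \<forall>\<^sub>F n in sequentially. \<forall>\<beta>\<in>S n. x \<notin> cyl (\<rho> n) \<beta>"
proof -
  define E where "E n m = (\<Union>\<beta>\<in>S n. cyl (\<rho> n) \<beta>) \<inter> cyl (- int m) 0" for n m
  have meas: "E n m \<in> sets \<mu>" for n m by (simp add: E_def sets.Int)
  have fmeas: "E n m \<in> fmeasurable \<mu>" for n m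
    by (rule fmeasurableI2[OF cyl_fmeasurable[of "- int m" 0]]) (auto simp: meas, auto simp: E_def)
  have "AE x in \<mu>. \<forall>\<^sub>F n in sequentially. x \<in> space \<mu> - E n m" for m
  proof (rule borel_cantelli_AE1)
    show "emeasure \<mu> (E n m) < \<infinity>" for n using fmeas by (simp add: fmeasurable_def)
    have "(\<lambda>n. q powi (int n - \<rho> n)) \<longlonglongrightarrow> 0" by (rule summable_LIMSEQ_zero[OF summable])
    then have "\<forall>\<^sub>F n in sequentially. q powi (int n - \<rho> n) < 1"
      by (rule order_tendstoD) simp
    \<comment> \<open>This is the condition k \<le> s of \<open>packing\<close> for k = -m and s = n
      + j.\<close>
    moreover have "\<forall>\<^sub>F n in sequentially. nat (- int m - j) \<le> n" by (rule eventually_ge_at_top)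
    ultimately have "\<forall>\<^sub>F n in sequentially. norm (measure \<mu> (E n m)) \<le> M * q powi (j + int m) * q powi (int n - \<rho> n)"
    proof eventually_elim
      case (elim n)
      \<comment> \<open>A weight below 1 means n < \<rho> n, so a target that meets the ball of
        index -m has its centre in that ball.\<close>
      have "q powi (int n - \<rho> n) < q powi 0" using elim by simp
      then have \<rho>: "int n < \<rho> n" using q_gt_1 by (simp add: powi_less_iff del: power_int_0_right)
      let ?F = "S n \<inter> cyl (- int m) 0"
      have F: "finite ?F" "real (card ?F) \<le> q powi (int n + j - (- int m))"
        using elim sep by (intro packing; auto)+
      have "E n m \<subseteq> (\<Union>\<beta>\<in>?F. cyl (\<rho> n) \<beta>)"
      proof
        fix y assume "y \<in> E n m"
        then obtain \<beta> where \<beta>: "\<beta> \<in> S n" "y \<in> cyl (\<rho> n) \<beta>" "y \<in> cyl (- int m) 0"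
          by (auto simp: E_def)
        have "\<beta> \<in> cyl (- int m) 0" using \<beta>(2,3) \<rho> by (auto simp: cyl_def)
        with \<beta> show "y \<in> (\<Union>\<beta>\<in>?F. cyl (\<rho> n) \<beta>)" by blast
      qed
      then have "measure \<mu> (E n m) \<le> measure \<mu> (\<Union>\<beta>\<in>?F. cyl (\<rho> n) \<beta>)"
        using F(1) by (intro measure_mono_fmeasurable meas fmeasurable.finite_UN) auto
      also have "\<dots> \<le> real (card ?F) * (M * q powi (- \<rho> n))" by (rule measure_UN_cyl_le[OF F(1)])
      also have "\<dots> \<le> q powi (int n + j - (- int m)) * (M * q powi (- \<rho> n))"
        using F(2) M_pos by (intro mult_right_mono) (auto simp: less_imp_le)
      also have "\<dots> = M * q powi (j + int m) * q powi (int n - \<rho> n)"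
        using powi_add[of "int n + j - (- int m)" "- \<rho> n"] powi_add[of "j + int m" "int n - \<rho> n"]
        by (simp add: algebra_simps)
      finally show ?case by simp
    qed
    then show "summable (\<lambda>n. measure \<mu> (E n m))"
      by (rule summable_comparison_test_ev) (intro summable_mult summable)
  qed (rule meas)
  then have "AE x in \<mu>. \<forall>m. \<forall>\<^sub>F n in sequentially. x \<in> space \<mu> - E n m"
    by (subst AE_all_countable) blast
  then show ?thesis
  proof eventually_elim
    case (elim x)
    obtain m where m: "x \<in> cyl (- int m) 0" using UN_cyl[where 'a='a] by blast
    from elim have "\<forall>\<^sub>F n in sequentially. x \<in> space \<mu> - E n m" by blast
    then show ?case by eventually_elim (use m in \<open>auto simp: E_def\<close>)
  qed
qed

text \<open>The complement of an open set is the intersection of its neighbourhoods by balls of a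
  fixed radius, so a uniform proportion in all balls already forces full measure.\<close>

lemma AE_open_of_positive_density:
  assumes "open G" "\<delta> > 0" "\<And>k x. \<delta> * measure \<mu> (cyl k x) \<le> measure \<mu> (cyl k x \<inter> G)"
  shows "AE x in \<mu>. x \<in> G"
proof (rule AE_of_null_in_cyl)
  have G: "G \<in> sets \<mu>" using assms(1) by (simp add: sets_borel borel_open)
  then show "{x. x \<in> G} \<in> sets \<mu>" by simp
  fix n
  define k0 where "k0 = - int n"
  define B where "B = (cyl k0 0 :: 'a fls set)"
  define Z where "Z = B - G"
  have Zm: "Z \<in> fmeasurable \<mu>" unfolding Z_def B_def by (intro fmeasurable_Diff G cyl_fmeasurable)
  define N where "N i = (\<Union>y\<in>Z. cyl (k0 + int i) y)" for i
  have N_sub: "N i \<subseteq> B" for i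
    unfolding N_def B_def Z_def using cyl_subset[of _ k0 0 "k0 + int i"] by auto
  have N_sets: "N i \<in> sets \<mu>" for i by (simp add: N_def)
  have N_fm: "N i \<in> fmeasurable \<mu>" for i
    using fmeasurableI2[OF cyl_fmeasurable[of k0 0]] N_sub N_sets unfolding B_def by blast
  have bound: "measure \<mu> Z \<le> (1 - \<delta>) * measure \<mu> (N i)" for i
  proof -
    let ?k = "k0 + int i"
    obtain K :: "'a fls set" where K: "finite K" "cyl k0 0 = (\<Union>z\<in>K. cyl ?k z)" "disjoint_family_on (cyl ?k) K"
      by (rule cyl_partition[of k0 ?k 0]) auto
    define K' where "K' = {z \<in> K. cyl ?k z \<inter> Z \<noteq> {}}"
    have K': "finite K'" "disjoint_family_on (cyl ?k) K'"
      using K by (auto simp: K'_def disjoint_family_on_def)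
    have N_eq: "N i = (\<Union>z\<in>K'. cyl ?k z)"
    proof (intro subset_antisym subsetI)
      fix w assume "w \<in> N i"
      then obtain y where y: "y \<in> Z" "w \<in> cyl ?k y" by (auto simp: N_def)
      then obtain z where z: "z \<in> K" "y \<in> cyl ?k z" using K(2) by (auto simp: Z_def B_def)
      then have "z \<in> K'" "w \<in> cyl ?k z" using y cyl_eq[OF z(2)] by (auto simp: K'_def)
      then show "w \<in> (\<Union>z\<in>K'. cyl ?k z)" by (rule UN_I)
    next
      fix w assume "w \<in> (\<Union>z\<in>K'. cyl ?k z)"
      then obtain z y where "w \<in> cyl ?k z" "y \<in> cyl ?k z" "y \<in> Z" by (auto simp: K'_def)
      then have "w \<in> cyl ?k y" using cyl_eq[of y ?k z] by simp
      with \<open>y \<in> Z\<close> show "w \<in> N i" by (auto simp: N_def)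
    qed
    have piece: "measure \<mu> (cyl ?k z \<inter> Z) \<le> (1 - \<delta>) * measure \<mu> (cyl ?k z)" for z
    proof -
      have "measure \<mu> (cyl ?k z \<inter> Z) \<le> measure \<mu> (cyl ?k z - (cyl ?k z \<inter> G))"
        using G fmeasurableD[OF Zm]
        by (intro measure_mono_fmeasurable fmeasurable_Diff) (auto simp: Z_def)
      also have "\<dots> = measure \<mu> (cyl ?k z) - measure \<mu> (cyl ?k z \<inter> G)"
        using G by (intro measure_Diff) (auto simp: emeasure_cyl)
      also have "\<dots> \<le> (1 - \<delta>) * measure \<mu> (cyl ?k z)"
        using assms(3)[of ?k z] by (simp add: algebra_simps)
      finally show ?thesis .
    qed
    have "Z \<subseteq> N i" by (auto simp: N_def intro: cyl_self)
    then have "Z \<subseteq> (\<Union>z\<in>K'. cyl ?k z \<inter> Z)" unfolding N_eq by auto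
    then have "measure \<mu> Z \<le> measure \<mu> (\<Union>z\<in>K'. cyl ?k z \<inter> Z)"
      using K' Zm by (intro measure_mono_fmeasurable fmeasurable.finite_UN fmeasurable_Int_fmeasurable) auto
    also have "\<dots> \<le> (\<Sum>z\<in>K'. measure \<mu> (cyl ?k z \<inter> Z))"
      using K' fmeasurableD[OF Zm] by (intro measure_UNION_le sets.Int) auto
    also have "\<dots> \<le> (\<Sum>z\<in>K'. (1 - \<delta>) * measure \<mu> (cyl ?k z))"
      by (intro sum_mono piece)
    also have "\<dots> = (1 - \<delta>) * measure \<mu> (N i)"
      unfolding N_eq using K'
      by (subst measure_finite_Union) (auto simp: sum_distrib_left emeasure_cyl)
    finally show ?thesis .
  qed
  have "(\<lambda>i. measure \<mu> (N i)) \<longlonglongrightarrow> measure \<mu> (\<Inter>i. N i)"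
  proof (rule Lim_measure_decseq)
    show "decseq N"
      unfolding decseq_def N_def by (intro allI impI UN_mono order_refl cyl_mono) simp
    show "emeasure \<mu> (N i) \<noteq> \<infinity>" for i using N_fm[of i] by (auto simp: fmeasurable_def)
  qed (use N_sets in auto)
  also have "(\<Inter>i. N i) = Z"
  proof (intro subset_antisym subsetI)
    fix y assume y: "y \<in> (\<Inter>i. N i)"
    have "y \<notin> G"
    proof
      assume "y \<in> G"
      then obtain m :: nat where m: "cyl (int m) y \<subseteq> G" using open_contains_cyl[OF assms(1)] by blast
      \<comment> \<open>Since k0 = -n, this neighbourhood has index m.\<close>
      have "y \<in> N (m + n)" using y by blast
      then obtain z where "z \<in> Z" "y \<in> cyl (int m) z" by (auto simp: N_def k0_def)
      then show False using m cyl_sym by (auto simp: Z_def)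
    qed
    moreover have "y \<in> B" using y N_sub by blast
    ultimately show "y \<in> Z" by (simp add: Z_def)
  qed (auto simp: N_def intro: cyl_self)
  \<comment> \<open>In the limit the neighbourhoods are replaced by Z itself, and the inequality
    leaves only the value 0.\<close>
  finally have "measure \<mu> Z \<le> (1 - \<delta>) * measure \<mu> Z"
    using bound by (intro LIMSEQ_le_const[OF tendsto_mult_left]) auto
  then have "\<delta> * measure \<mu> Z \<le> 0" by (simp add: algebra_simps)
  then have "measure \<mu> Z = 0"
    using assms(2) measure_nonneg[of \<mu> Z] by (auto simp: mult_le_0_iff)
  then show "emeasure \<mu> (cyl (- int n) 0 - {x. x \<in> G}) = 0"
    using emeasure_eq_measure2[OF Zm] by (simp add: Z_def B_def k0_def)
qed

end

text \<open>The set \<open>S N\<close> consists of centres that are separated at the scale $q^{-4N}$, and the targets at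
  time \<open>N\<close> are the balls of radius $q^{-\rho(N)}$ around them.\<close>

locale target_system = haar_fls \<mu> M q for \<mu> :: "'a::{field,finite} fls measure" and M q +
  fixes S :: "nat \<Rightarrow> 'a fls set" and \<rho> :: "nat \<Rightarrow> int" and j :: int and \<kappa> \<eta> :: real
  assumes \<kappa>_pos: "\<kappa> > 0"
    and \<eta>_def: "\<eta> = 1 / (4 * \<kappa> * q powi (2 * j))"
    and sep: "N \<le> N' \<Longrightarrow> \<beta> \<in> S N \<Longrightarrow> \<beta>' \<in> S N' \<Longrightarrow> \<beta> \<noteq> \<beta>' \<Longrightarrow> \<beta>' \<notin> cyl (4 * int N' + j) \<beta>"
    and disj: "N \<noteq> N' \<Longrightarrow> S N \<inter> S N' = {}"
    and ubiquity: "\<exists>N0. \<forall>N\<ge>N0. q powi (4 * int N - k) / \<kappa> \<le> real (card (S N \<inter> cyl k x))"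
    and \<rho>_ge: "\<rho> N \<ge> 4 * int N + j"
    and weight_le: "q powi (4 * int N - \<rho> N) \<le> \<eta>"
    and weight_not_summable: "\<not> summable (\<lambda>N. q powi (4 * int N - \<rho> N))"
begin

text \<open>Up to constants, the share of a ball covered at time N: about q^(4N - k) targets of mass
  M q^(- \<rho> N) in a ball of mass M q^(-k).\<close>

definition w :: "nat \<Rightarrow> real" where
  "w N = q powi (4 * int N - \<rho> N)"

text \<open>The centres are restricted to the ball, rather than the targets intersected with it;
  thus \<open>A\<close> is a union of whole balls and its mass is a count.\<close>

definition A :: "int \<Rightarrow> 'a fls \<Rightarrow> nat \<Rightarrow> 'a fls set" where
  "A k x N = (\<Union>\<beta>\<in>S N \<inter> cyl k x. cyl (\<rho> N) \<beta>)"

lemma w_pos: "w N > 0"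
  by (simp add: w_def)

lemma w_le: "w N \<le> \<eta>"
  unfolding w_def by (rule weight_le)

lemma not_summable: "\<not> summable w"
  using weight_not_summable by (simp add: w_def[abs_def])

lemma \<eta>_pos: "\<eta> > 0"
  using \<kappa>_pos by (simp add: \<eta>_def)

lemma A_sets [simp]: "A k x N \<in> sets \<mu>"
  by (simp add: A_def)

lemma finite_targets:
  assumes "k \<le> 4 * int N + j"
  shows "finite (S N \<inter> cyl k x)" "real (card (S N \<inter> cyl k x)) \<le> q powi (4 * int N + j - k)"
  using sep[of N N] assms by (intro packing; auto)+

lemma A_subset:
  assumes "k \<le> 4 * int N + j"
  shows "A k x N \<subseteq> cyl k x"
  using cyl_subset[of _ k x "\<rho> N"] \<rho>_ge[of N] assms by (fastforce simp: A_def)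

lemma A_fmeasurable: "k \<le> 4 * int N + j \<Longrightarrow> A k x N \<in> fmeasurable \<mu>"
  using fmeasurableI2[OF cyl_fmeasurable A_subset A_sets] .

lemma measure_A:
  assumes "k \<le> 4 * int N + j"
  shows "measure \<mu> (A k x N) = real (card (S N \<inter> cyl k x)) * (M * q powi (- \<rho> N))"
proof -
  have "cyl (\<rho> N) \<beta> \<inter> cyl (\<rho> N) \<beta>' = {}" if "\<beta> \<in> S N" "\<beta>' \<in> S N" "\<beta> \<noteq> \<beta>'" for \<beta> \<beta>'
    using sep[OF order_refl that] cyl_mono[OF \<rho>_ge[of N], of \<beta>] by (intro cyl_disjoint) blast
  then show ?thesis
    unfolding A_def using finite_targets(1)[OF assms]
    by (subst measure_finite_Union) (auto simp: disjoint_family_on_def measure_cyl emeasure_cyl)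
qed

text \<open>If the ball around \<beta> is finer than the separation scale of time N', a target of
  time N' meeting it would have its centre, which differs from \<beta>, too close to \<beta>.
  Otherwise the centres of the targets meeting the ball lie in it, and \<open>packing\<close> gives
  at most q^j times the share \<open>w N'\<close> expected under independence.\<close>

lemma measure_cyl_Int_A:
  assumes "N < N'" "\<beta> \<in> S N"
  shows "measure \<mu> (cyl (\<rho> N) \<beta> \<inter> A k x N') \<le> M * q powi (- \<rho> N) * q powi j * w N'"
proof -
  have nonneg: "0 \<le> M * q powi (- \<rho> N) * q powi j * w N'"
    using M_pos w_pos[of N'] by (intro mult_nonneg_nonneg) (auto simp: less_imp_le)
  have neq: "\<beta>' \<noteq> \<beta>" if "\<beta>' \<in> S N'" for \<beta>' using disj[of N N'] assms that by auto
  show ?thesis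
  proof (cases "4 * int N' + j \<le> \<rho> N")
    case True
    have "cyl (\<rho> N) \<beta> \<inter> A k x N' = {}"
    proof (rule ccontr)
      assume "cyl (\<rho> N) \<beta> \<inter> A k x N' \<noteq> {}"
      then obtain y \<beta>' where *: "y \<in> cyl (\<rho> N) \<beta>" "\<beta>' \<in> S N'" "y \<in> cyl (\<rho> N') \<beta>'"
        by (auto simp: A_def)
      then have "\<beta>' \<in> cyl (4 * int N' + j) \<beta>"
        using subsetD[OF cyl_mono[OF True] *(1)] subsetD[OF cyl_mono[OF \<rho>_ge] *(3)]
        by (simp add: cyl_eq cyl_sym[of \<beta>'])
      then show False using sep[of N N' \<beta> \<beta>'] assms neq[of \<beta>'] * by auto
    qed
    then show ?thesis using nonneg by simp
  next
    case False
    define F where "F = S N' \<inter> cyl (\<rho> N) \<beta>"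
    have F: "finite F" "real (card F) \<le> q powi (4 * int N' + j - \<rho> N)"
      unfolding F_def using False sep[of N' N'] by (intro packing; auto)+
    have "cyl (\<rho> N) \<beta> \<inter> A k x N' \<subseteq> (\<Union>\<beta>'\<in>F. cyl (\<rho> N') \<beta>')"
    proof
      fix y assume "y \<in> cyl (\<rho> N) \<beta> \<inter> A k x N'"
      then obtain \<beta>' where *: "y \<in> cyl (\<rho> N) \<beta>" "\<beta>' \<in> S N'" "y \<in> cyl (\<rho> N') \<beta>'"
        by (auto simp: A_def)
      then have "\<beta>' \<in> cyl (\<rho> N) \<beta>" using False \<rho>_ge[of N'] by (auto simp: cyl_def)
      with * show "y \<in> (\<Union>\<beta>'\<in>F. cyl (\<rho> N') \<beta>')" by (auto simp: F_def)
    qed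
    then have "measure \<mu> (cyl (\<rho> N) \<beta> \<inter> A k x N') \<le> measure \<mu> (\<Union>\<beta>'\<in>F. cyl (\<rho> N') \<beta>')"
      using F(1) by (intro measure_mono_fmeasurable fmeasurable.finite_UN sets.Int) auto
    also have "\<dots> \<le> real (card F) * (M * q powi (- \<rho> N'))" by (rule measure_UN_cyl_le[OF F(1)])
    also have "\<dots> \<le> q powi (4 * int N' + j - \<rho> N) * (M * q powi (- \<rho> N'))"
      using F(2) M_pos by (intro mult_right_mono) (auto simp: less_imp_le)
    also have "\<dots> = M * q powi (- \<rho> N) * q powi j * w N'"
      using powi_add[of "4 * int N' + j - \<rho> N" "- \<rho> N'"] powi_add[of "- \<rho> N" j]
        powi_add[of "j - \<rho> N" "4 * int N' - \<rho> N'"]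
      by (simp add: w_def algebra_simps)
    finally show ?thesis .
  qed
qed

text \<open>One factor q^j comes from counting the centres of time N, the other from
  \<open>measure_cyl_Int_A\<close> applied around each of them.\<close>

lemma quasi_independence:
  assumes "N < N'" "k \<le> 4 * int N + j"
  shows "measure \<mu> (A k x N \<inter> A k x N') \<le> M * q powi (- k) * q powi (2 * j) * w N * w N'"
proof -
  let ?F = "S N \<inter> cyl k x"
  note F = finite_targets[OF assms(2), of x]
  have "A k x N \<inter> A k x N' = (\<Union>\<beta>\<in>?F. cyl (\<rho> N) \<beta> \<inter> A k x N')"
    by (auto simp: A_def)
  also have "measure \<mu> \<dots> \<le> (\<Sum>\<beta>\<in>?F. measure \<mu> (cyl (\<rho> N) \<beta> \<inter> A k x N'))"
    using F(1) by (intro measure_UNION_le sets.Int) auto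
  also have "\<dots> \<le> (\<Sum>\<beta>\<in>?F. M * q powi (- \<rho> N) * q powi j * w N')"
    using assms(1) by (intro sum_mono measure_cyl_Int_A) auto
  also have "\<dots> = real (card ?F) * (M * q powi (- \<rho> N) * q powi j * w N')" by simp
  also have "\<dots> \<le> q powi (4 * int N + j - k) * (M * q powi (- \<rho> N) * q powi j * w N')"
    using F(2) M_pos w_pos[of N'] by (intro mult_right_mono) (auto simp: less_imp_le)
  also have "\<dots> = M * q powi (- k) * q powi (2 * j) * w N * w N'"
  proof -
    have "q powi (4 * int N + j - k) * q powi (- \<rho> N) * q powi j = q powi (- k) * q powi (2 * j) * w N"
      unfolding w_def powi_add[symmetric] by (simp add: algebra_simps)
    then show ?thesis by (simp add: mult_ac)
  qed
  finally show ?thesis .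
qed

text \<open>Stop when the partial sum first reaches \<eta>; a single weight is at most \<eta>, and
  so is the overshoot.\<close>

lemma window:
  obtains T where "\<eta> \<le> (\<Sum>N\<in>{N2..<N2 + T}. w N)" "(\<Sum>N\<in>{N2..<N2 + T}. w N) \<le> 2 * \<eta>"
proof -
  let ?s = "\<lambda>T. \<Sum>N\<in>{N2..<N2 + T}. w N"
  have "\<exists>T. \<eta> \<le> ?s T"
  proof (rule ccontr)
    assume "\<nexists>T. \<eta> \<le> ?s T"
    then have "(\<Sum>N\<in>{N2..<N2 + T}. w N) \<le> \<eta>" for T by (simp add: not_le less_imp_le)
    moreover have "(\<Sum>N\<in>{N2..<N2 + T}. w N) = (\<Sum>i<T. w (i + N2))" for T
      using sum.shift_bounds_nat_ivl[of w 0 N2 T] by (simp add: lessThan_atLeast0 add.commute)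
    ultimately have "(\<Sum>i<T. w (i + N2)) \<le> \<eta>" for T by metis
    then have "summable (\<lambda>i. w (i + N2))"
      using w_pos by (intro summableI_nonneg_bounded) (auto simp: less_imp_le)
    then show False using not_summable by simp
  qed
  then have *: "\<eta> \<le> ?s (LEAST T. \<eta> \<le> ?s T)" by (rule LeastI_ex)
  define T where "T = (LEAST T. \<eta> \<le> ?s T)"
  have T: "\<eta> \<le> ?s T" using * by (simp add: T_def)
  moreover from T \<eta>_pos obtain T' where T': "T = Suc T'" by (cases T) auto
  have "\<not> \<eta> \<le> ?s T'"
    using not_less_Least[of T' "\<lambda>T. \<eta> \<le> ?s T"] T' by (simp add: T_def)
  then have "?s T \<le> 2 * \<eta>" using w_le[of "N2 + T'"] by (simp add: T')
  ultimately show ?thesis by (rule that)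
qed

text \<open>In a window of total weight between \<eta> and 2 \<eta>, remove from each
  \<open>A k x N\<close> its overlaps with earlier times of the window. The loss is at most half of
  the lower bound for \<open>A k x N\<close>, and the remaining sets are disjoint, so their masses
  add up. The window may start arbitrarily late, hence the share is independent of
  \<open>N1\<close>.\<close>

lemma hit_lower_bound:
  "\<eta> / (2 * \<kappa>) * measure \<mu> (cyl k x) \<le> measure \<mu> (cyl k x \<inter> (\<Union>N\<in>{N1..}. \<Union>\<beta>\<in>S N. cyl (\<rho> N) \<beta>))"
proof -
  let ?B = "M * q powi (- k)"
  have B: "?B > 0" using M_pos by simp
  obtain N0 where N0: "\<And>N. N \<ge> N0 \<Longrightarrow> q powi (4 * int N - k) / \<kappa> \<le> real (card (S N \<inter> cyl k x))"
    using ubiquity[of k x] by blast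
  \<comment> \<open>From \<open>N2\<close> on, ubiquity holds in this ball, the time is at least
    \<open>N1\<close>, and the separation scale does not exceed the radius of the ball.\<close>
  define N2 where "N2 = max (max N0 N1) (nat (k - j))"
  have N2: "N0 \<le> N" "N1 \<le> N" "k \<le> 4 * int N + j" if "N \<ge> N2" for N
    using that by (auto simp: N2_def)
  obtain T where T: "\<eta> \<le> (\<Sum>N\<in>{N2..<N2 + T}. w N)" "(\<Sum>N\<in>{N2..<N2 + T}. w N) \<le> 2 * \<eta>"
    by (rule window)
  let ?I = "{N2..<N2 + T}"
  define D where "D N = A k x N - (\<Union>N'\<in>{N2..<N}. A k x N')" for N
  have D_fm: "D N \<in> fmeasurable \<mu>" if "N \<ge> N2" for N
    unfolding D_def using that N2 by (intro fmeasurable_Diff A_fmeasurable sets.finite_UN) auto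
  have D_ge: "?B * w N / (2 * \<kappa>) \<le> measure \<mu> (D N)" if N: "N \<in> ?I" for N
  proof -
    have kN: "k \<le> 4 * int N + j" and kN': "\<And>N'. N' \<in> {N2..<N} \<Longrightarrow> k \<le> 4 * int N' + j"
      using N N2 by auto
    have "?B * w N / \<kappa> = (q powi (4 * int N - k) / \<kappa>) * (M * q powi (- \<rho> N))"
      using powi_add[of "4 * int N - k" "- \<rho> N"] powi_add[of "- k" "4 * int N - \<rho> N"]
      by (simp add: w_def algebra_simps)
    also have "\<dots> \<le> measure \<mu> (A k x N)"
      unfolding measure_A[OF kN] using N0[of N] N2[of N] N M_pos
      by (intro mult_right_mono) (auto simp: less_imp_le)
    also have "\<dots> \<le> measure \<mu> (D N \<union> (\<Union>N'\<in>{N2..<N}. A k x N' \<inter> A k x N))"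
    proof (rule measure_mono_fmeasurable)
      show "D N \<union> (\<Union>N'\<in>{N2..<N}. A k x N' \<inter> A k x N) \<in> fmeasurable \<mu>"
        using N kN' D_fm[of N]
        by (intro fmeasurable.Un fmeasurable.finite_UN fmeasurable_Int_fmeasurable A_fmeasurable) simp_all
    qed (auto simp: D_def)
    also have "\<dots> \<le> measure \<mu> (D N) + measure \<mu> (\<Union>N'\<in>{N2..<N}. A k x N' \<inter> A k x N)"
    proof (rule measure_Un_le)
      show "D N \<in> sets \<mu>" using D_fm N by (auto dest: fmeasurableD)
      show "(\<Union>N'\<in>{N2..<N}. A k x N' \<inter> A k x N) \<in> sets \<mu>"
        by (intro sets.finite_UN sets.Int A_sets) auto
    qed
    also have "measure \<mu> (\<Union>N'\<in>{N2..<N}. A k x N' \<inter> A k x N) \<le> (\<Sum>N'\<in>{N2..<N}. measure \<mu> (A k x N' \<inter> A k x N))"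
      by (intro measure_UNION_le) auto
    also have "\<dots> \<le> (\<Sum>N'\<in>{N2..<N}. ?B * q powi (2 * j) * w N * w N')"
    proof (rule sum_mono)
      fix N' assume "N' \<in> {N2..<N}"
      then show "measure \<mu> (A k x N' \<inter> A k x N) \<le> ?B * q powi (2 * j) * w N * w N'"
        using quasi_independence[of N' N k x] kN'[of N'] by (simp add: mult_ac)
    qed
    also have "\<dots> = ?B * q powi (2 * j) * w N * (\<Sum>N'\<in>{N2..<N}. w N')" by (simp add: sum_distrib_left)
    also have "\<dots> \<le> ?B * q powi (2 * j) * w N * (2 * \<eta>)"
    proof (rule mult_left_mono)
      have "(\<Sum>N'\<in>{N2..<N}. w N') \<le> (\<Sum>N\<in>?I. w N)"
        using N w_pos by (intro sum_mono2) (auto simp: less_imp_le)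
      with T(2) show "(\<Sum>N'\<in>{N2..<N}. w N') \<le> 2 * \<eta>" by linarith
    qed (use B w_pos[of N] in \<open>auto intro!: mult_nonneg_nonneg simp: less_imp_le\<close>)
    \<comment> \<open>The choice of \<eta> gives 2 \<eta> q^(2j) = 1 / (2 \<kappa>), half of the
      factor 1 / \<kappa> in the bound for \<open>A k x N\<close>.\<close>
    also have "\<dots> = ?B * w N / (2 * \<kappa>)"
      using \<kappa>_pos q_gt_1 powi_pos[of "2 * j"] unfolding \<eta>_def by (simp add: field_simps del: powi_pos)
    finally have *: "?B * w N / \<kappa> \<le> measure \<mu> (D N) + ?B * w N / (2 * \<kappa>)" by simp
    have "?B * w N / \<kappa> = ?B * w N / (2 * \<kappa>) + ?B * w N / (2 * \<kappa>)" using \<kappa>_pos by (simp add: field_simps)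
    with * show ?thesis by linarith
  qed
  have "\<eta> / (2 * \<kappa>) * measure \<mu> (cyl k x) = ?B / (2 * \<kappa>) * \<eta>" by (simp add: measure_cyl)
  also have "\<dots> \<le> ?B / (2 * \<kappa>) * (\<Sum>N\<in>?I. w N)"
    using B \<kappa>_pos T(1) by (intro mult_left_mono) auto
  also have "\<dots> = (\<Sum>N\<in>?I. ?B * w N / (2 * \<kappa>))" by (simp add: sum_distrib_left)
  also have "\<dots> \<le> (\<Sum>N\<in>?I. measure \<mu> (D N))" by (intro sum_mono D_ge)
  also have "\<dots> = measure \<mu> (\<Union>N\<in>?I. D N)"
  proof (rule measure_UNION'[symmetric])
    show "pairwise (\<lambda>i l. disjnt (D i) (D l)) ?I"
    proof (rule pairwiseI)
      fix i l assume "i \<in> ?I" "l \<in> ?I" "i \<noteq> l"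
      then show "disjnt (D i) (D l)"
        by (cases i l rule: linorder_cases) (auto simp: D_def disjnt_def)
    qed
  qed (use D_fm in auto)
  also have "\<dots> \<le> measure \<mu> (cyl k x \<inter> (\<Union>N\<in>{N1..}. \<Union>\<beta>\<in>S N. cyl (\<rho> N) \<beta>))"
  proof (rule measure_mono_fmeasurable)
    show "(\<Union>N\<in>?I. D N) \<subseteq> cyl k x \<inter> (\<Union>N\<in>{N1..}. \<Union>\<beta>\<in>S N. cyl (\<rho> N) \<beta>)"
    proof
      fix y assume "y \<in> (\<Union>N\<in>?I. D N)"
      then obtain N where N: "N \<ge> N2" "y \<in> A k x N" by (auto simp: D_def)
      then show "y \<in> cyl k x \<inter> (\<Union>N\<in>{N1..}. \<Union>\<beta>\<in>S N. cyl (\<rho> N) \<beta>)"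
        using A_subset[of k N x] N2[of N] by (auto simp: A_def)
    qed
    show "cyl k x \<inter> (\<Union>N\<in>{N1..}. \<Union>\<beta>\<in>S N. cyl (\<rho> N) \<beta>) \<in> fmeasurable \<mu>"
      by (intro fmeasurable_Int_fmeasurable cyl_fmeasurable sets.countable_UN') auto
  qed (use D_fm in \<open>auto intro!: sets.finite_UN dest: fmeasurableD\<close>)
  finally show ?thesis .
qed

theorem AE_hits_infinitely_often:
  "AE x in \<mu>. \<forall>N1. \<exists>N\<ge>N1. \<exists>\<beta>\<in>S N. x \<in> cyl (\<rho> N) \<beta>"
proof -
  have "AE x in \<mu>. x \<in> (\<Union>N\<in>{N1..}. \<Union>\<beta>\<in>S N. cyl (\<rho> N) \<beta>)" for N1
    by (rule AE_open_of_positive_density[OF _ _ hit_lower_bound])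
      (use \<eta>_pos \<kappa>_pos in \<open>auto intro!: open_UN\<close>)
  then have "AE x in \<mu>. \<forall>N1. x \<in> (\<Union>N\<in>{N1..}. \<Union>\<beta>\<in>S N. cyl (\<rho> N) \<beta>)"
    by (subst AE_all_countable) blast
  then show ?thesis by eventually_elim fastforce
qed

end

subsection \<open>Ubiquity of a congruence class\<close>

text \<open>The induction step is a step of the continued fraction algorithm, with signs chosen so that the
  matrices keep determinant one.\<close>

lemma dirichlet:
  fixes x :: "'a::{field,finite} fls"
  defines "q \<equiv> real CARD('a)"
  shows "\<exists>P R Q S. P * S - R * Q = 1 \<and> Q \<noteq> 0 \<and> abs_inf (emb_poly Q) \<le> q ^ N \<and>
    abs_inf (emb_poly S) < abs_inf (emb_poly Q) \<and>
    abs_inf (emb_poly Q * x - emb_poly P) \<le> q powi (- int (N + 1))"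
proof (induction N)
  case 0
  obtain p where "abs_inf (x - emb_poly p) \<le> inverse q"
    unfolding q_def by (rule emb_poly_part)
  \<comment> \<open>The initial matrix has rows (p, -1) and (1, 0), with p the integer part of
    x.\<close>
  then show ?case
    by (intro exI[of _ p] exI[of _ "- 1"] exI[of _ 1] exI[of _ 0]) (simp add: power_int_minus)
next
  case (Suc N)
  have q: "q > 1" using card_field_gt_1[where 'a='a] by (simp add: q_def)
  obtain P R Q S where *: "P * S - R * Q = 1" "Q \<noteq> 0" "abs_inf (emb_poly Q) \<le> q ^ N"
    "abs_inf (emb_poly S) < abs_inf (emb_poly Q)"
    "abs_inf (emb_poly Q * x - emb_poly P) \<le> q powi (- int (N + 1))"
    using Suc by blast
  define \<delta> where "\<delta> = emb_poly Q * x - emb_poly P"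
  show ?case
  proof (cases "abs_inf \<delta> \<le> q powi (- int (Suc N + 1))")
    case True
    have "q ^ N \<le> q ^ Suc N" using q by simp
    with * True show ?thesis unfolding \<delta>_def by (meson order_trans)
  next
    case False
    then have \<delta>0: "\<delta> \<noteq> 0" using q by auto
    then obtain m where m: "abs_inf \<delta> = q powi (- m)" unfolding q_def by (rule abs_inf_eq_powi)
    have "- int (Suc N + 1) < - m" "- m \<le> - int (N + 1)"
      using False *(5) q unfolding \<delta>_def[symmetric] m by (simp_all only: not_le powi_less_iff powi_le_iff)
    \<comment> \<open>Absolute values are powers of q, so an error that misses the next bound is
      exactly q^(-(N + 1)).\<close>
    then have "m = int (N + 1)" by simp
    with m have \<delta>: "abs_inf \<delta> = 1 / q ^ (N + 1)"
      by (simp only: power_int_minus power_int_of_nat inverse_eq_divide)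
    \<comment> \<open>\<open>y\<close> is the error of the other column (R, S). The determinant
      gives Q y = 1 + S \<delta>, hence |y| = 1 / |Q|.\<close>
    define y where "y = emb_poly S * x - emb_poly R"
    have "emb_poly Q * y - emb_poly S * \<delta> = emb_poly (P * S - R * Q)"
      by (simp add: y_def \<delta>_def emb_poly_simps algebra_simps)
    then have Qy: "emb_poly Q * y = 1 + emb_poly S * \<delta>" unfolding *(1) by (simp add: algebra_simps)
    have "abs_inf (emb_poly S) < q ^ N" using * by linarith
    also have "\<dots> \<le> q ^ (N + 1)" using q by simp
    finally have "abs_inf (emb_poly S * \<delta>) < 1" using q by (simp add: abs_inf_mult \<delta>)
    then have "abs_inf (emb_poly Q * y) = 1"
      unfolding Qy using abs_inf_add_eq(2)[of "emb_poly S * \<delta>" 1] by simp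
    then have y: "abs_inf y = 1 / abs_inf (emb_poly Q)"
      using *(2) by (simp add: abs_inf_mult field_simps)
    \<comment> \<open>The next partial quotient; removing the integer part of y / \<delta> gains a
      factor 1/q in the error.\<close>
    obtain a where a: "abs_inf (y / \<delta> - emb_poly a) \<le> inverse q"
      unfolding q_def by (rule emb_poly_part)
    have yd: "abs_inf (y / \<delta>) = q ^ (N + 1) / abs_inf (emb_poly Q)"
      by (simp add: abs_inf_divide y \<delta>)
    have "q \<le> abs_inf (y / \<delta>)"
      unfolding yd using *(2,3) q by (simp add: le_divide_eq)
    moreover have "inverse q < q" using q by (meson less_trans one_less_inverse_iff inverse_less_1_iff)
    ultimately have "abs_inf (- (y / \<delta> - emb_poly a)) < abs_inf (y / \<delta>)"
      using a unfolding abs_inf_uminus by linarith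
    from abs_inf_add_eq(1)[OF this]
    have "abs_inf (emb_poly a) = abs_inf (y / \<delta>)" by simp
    then have aQ: "abs_inf (emb_poly (a * Q)) = q ^ (N + 1)"
      using yd *(2) by (simp add: emb_poly_mult abs_inf_mult)
    have "abs_inf (- emb_poly S) < abs_inf (emb_poly (a * Q))"
      unfolding aQ abs_inf_uminus using \<open>abs_inf (emb_poly S) < q ^ N\<close> \<open>q ^ N \<le> q ^ (N + 1)\<close> by linarith
    from abs_inf_add_eq(1)[OF this]
    have Q': "abs_inf (emb_poly (S - a * Q)) = q ^ (N + 1)"
      using aQ abs_inf_diff_commute[of "emb_poly S" "emb_poly (a * Q)"] by (simp add: emb_poly_diff)
    have "emb_poly (S - a * Q) * x - emb_poly (R - a * P) = (y / \<delta> - emb_poly a) * \<delta>"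
      using \<delta>0 by (simp add: left_diff_distrib) (simp add: y_def \<delta>_def emb_poly_simps algebra_simps)
    then have "abs_inf (emb_poly (S - a * Q) * x - emb_poly (R - a * P)) \<le> inverse q * abs_inf \<delta>"
      using a by (simp add: abs_inf_mult mult_right_mono)
    also have "\<dots> = q powi (- int (Suc N + 1))"
      unfolding \<delta> power_int_minus power_int_of_nat using q by (simp add: field_simps)
    finally have "abs_inf (emb_poly (S - a * Q) * x - emb_poly (R - a * P)) \<le> q powi (- int (Suc N + 1))" .
    \<comment> \<open>The old column moves to the second place with opposite sign, which preserves
      the determinant.\<close>
    moreover have "(R - a * P) * (- Q) - (- P) * (S - a * Q) = 1"
      using *(1) by (simp add: algebra_simps)
    moreover have "q ^ (N + 1) > 0" using q by simp
    then have "S - a * Q \<noteq> 0" using Q' by (metis emb_poly_0 abs_inf_0 less_irrefl)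
    moreover have "abs_inf (emb_poly (- Q)) < abs_inf (emb_poly (S - a * Q))"
      unfolding Q' emb_poly_minus abs_inf_uminus using *(3) q
      by (meson le_less_trans power_strict_increasing less_add_one)
    ultimately show ?thesis using Q' by (metis Suc_eq_plus1 order_refl)
  qed
qed

definition fractions_of_degree :: "nat \<Rightarrow> 'a::field fls set" where
  "fractions_of_degree n = {emb_poly P / emb_poly Q | P Q. Q \<noteq> 0 \<and> degree Q = n}"

text \<open>A nonzero difference has a polynomial numerator, of absolute value at least 1, over a
  denominator of absolute value q^(2n).\<close>

lemma fractions_separated:
  fixes y y' :: "'a::{field,finite} fls"
  assumes "y \<in> fractions_of_degree n" "y' \<in> fractions_of_degree n" "y \<noteq> y'"
  shows "y' \<notin> cyl (2 * int n + 1) y"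
proof -
  obtain P Q P' Q' where *: "y = emb_poly P / emb_poly Q" "Q \<noteq> 0" "degree Q = n"
    "y' = emb_poly P' / emb_poly Q'" "Q' \<noteq> 0" "degree Q' = n"
    using assms(1,2) by (auto simp: fractions_of_degree_def)
  have q: "real CARD('a) > 1" by (rule card_field_gt_1)
  have eq: "y - y' = emb_poly (P * Q' - P' * Q) / (emb_poly Q * emb_poly Q')"
    using * by (simp add: diff_frac_eq emb_poly_simps)
  with assms(3) have "P * Q' - P' * Q \<noteq> 0" by auto
  then have "1 / real CARD('a) ^ (2 * n) \<le> abs_inf (y - y')"
    unfolding eq abs_inf_divide abs_inf_mult using abs_inf_emb_poly_ge_1[of "P * Q' - P' * Q"] * q
    by (simp add: abs_inf_emb_poly[of Q] abs_inf_emb_poly[of Q'] divide_right_mono mult_2 power_add)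
  moreover have "real CARD('a) powi (- (2 * int n + 1)) < real CARD('a) powi (- int (2 * n))"
    using q by (subst powi_less_iff) auto
  then have "real CARD('a) powi (- (2 * int n + 1)) < 1 / real CARD('a) ^ (2 * n)"
    by (simp only: power_int_minus power_int_of_nat inverse_eq_divide)
  ultimately show ?thesis unfolding cyl_iff_abs_inf by linarith
qed

text \<open>With both roots of absolute value q^e, the term Q \<alpha> dominates T in Q \<alpha> + T
  whenever |T| < |Q|, and likewise for the conjugate. Every pair reaches this form by a polynomial
  translation.\<close>

locale balanced_pair = quadratic_pair \<alpha> \<alpha>' A B C + haar_fls \<mu> M q
  for \<alpha> \<alpha>' :: "'a::{field,finite} fls" and A B C and \<mu> :: "'a fls measure" and M q +
  fixes e :: nat
  assumes e_pos: "e > 0" and abs_\<alpha>: "abs_inf \<alpha> = q ^ e" and abs_\<alpha>': "abs_inf \<alpha>' = q ^ e"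
begin

text \<open>A Dirichlet matrix with denominator of degree n maps \<alpha> to height exactly c0
  q^(2n): each of the two denominators contributes q^(n + e).\<close>

definition c0 :: real where "c0 = q ^ (2 * e) * height \<alpha>"

text \<open>The window is closed at both ends because it must contain the heights for n = L - 1 and
  n = L.\<close>

definition S :: "nat \<Rightarrow> 'a fls set" where
  "S L = {\<beta> \<in> congruence_class \<alpha>. c0 * q powi (2 * int L - 2) \<le> height \<beta> \<and> height \<beta> \<le> c0 * q powi (2 * int L)}"

lemma c0_pos: "c0 > 0"
  using separable q_gt_1 by (simp add: c0_def height_def conj)

text \<open>Let P/Q be the Dirichlet fraction of y and n \<le> L the degree of Q. If n \<ge> L - 1,
  applying the matrix to \<alpha> gives an element of \<open>S L\<close> near y; if not, y is
  exceptionally close to a fraction of small denominator.\<close>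

lemma dirichlet_dichotomy:
  assumes "L \<ge> 1"
  shows "(\<exists>\<beta>\<in>S L. y \<in> cyl (2 * int L - 1) \<beta>) \<or>
    (\<exists>n<L - 1. \<exists>z\<in>fractions_of_degree n. y \<in> cyl (int L + int n + 1) z)"
proof -
  obtain P R Q T where *: "P * T - R * Q = 1" "Q \<noteq> 0" "abs_inf (emb_poly Q) \<le> q ^ L"
    "abs_inf (emb_poly T) < abs_inf (emb_poly Q)"
    "abs_inf (emb_poly Q * y - emb_poly P) \<le> q powi (- int (L + 1))"
    using dirichlet[of L y] unfolding q_def by blast
  define n where "n = degree Q"
  have absQ: "abs_inf (emb_poly Q) = q powi int n"
    using *(2) by (simp add: abs_inf_emb_poly n_def q_def)
  have nL: "n \<le> L" using *(3) q_gt_1 unfolding absQ by simp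
  define z where "z = emb_poly P / emb_poly Q"
  have "z - y = - ((emb_poly Q * y - emb_poly P) / emb_poly Q)"
    using *(2) by (simp add: z_def field_simps)
  then have "abs_inf (z - y) = abs_inf (emb_poly Q * y - emb_poly P) / q powi int n"
    by (simp only: abs_inf_uminus abs_inf_divide absQ)
  also have "\<dots> \<le> q powi (- int (L + 1)) / q powi int n"
    by (intro divide_right_mono *(5)) (use q_gt_1 in simp)
  also have "\<dots> = q powi (- (int L + int n + 1))"
  proof -
    have "- (int L + int n + 1) = - int (L + 1) - int n" by simp
    moreover have "q \<noteq> 0" using q_gt_1 by simp
    ultimately show ?thesis by (simp only: power_int_diff simp_thms)
  qed
  finally have zy: "abs_inf (z - y) \<le> q powi (- (int L + int n + 1))" .
  show ?thesis
  proof (cases "n < L - 1")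
    case True
    have "z \<in> fractions_of_degree n"
      using *(2) by (auto simp: fractions_of_degree_def z_def n_def)
    with True zy show ?thesis unfolding cyl_iff_abs_inf q_def by blast
  next
    case False
    have den: "abs_inf (emb_poly Q * t + emb_poly T) = q powi int n * q ^ e" if "abs_inf t = q ^ e" for t
    proof -
      have "abs_inf (emb_poly Q) \<le> abs_inf (emb_poly Q * t)"
        using that q_gt_1 abs_inf_nonneg[of "emb_poly Q"]
        by (auto simp: abs_inf_mult mult_le_cancel_left1 simp del: abs_inf_nonneg)
      with *(4) have "abs_inf (emb_poly T) < abs_inf (emb_poly Q * t)" by linarith
      then have "abs_inf (emb_poly Q * t + emb_poly T) = abs_inf (emb_poly Q * t)"
        by (rule abs_inf_add_eq(2))
      then show ?thesis by (simp add: abs_inf_mult absQ that)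
    qed
    define \<beta> where "\<beta> = mobius P R Q T \<alpha>"
    have \<beta>C: "\<beta> \<in> congruence_class \<alpha>" using *(1) by (auto simp: \<beta>_def congruence_class_eq)
    have "height \<beta> = c0 * q powi (2 * int n)"
      unfolding \<beta>_def height_mobius[OF *(1)] den[OF abs_\<alpha>] den[OF abs_\<alpha>']
        c0_def mult_2 powi_add power_add by (simp add: mult_ac)
    then have "\<beta> \<in> S L"
      using \<beta>C False nL c0_pos q_gt_1 by (auto simp: S_def powi_le_iff)
    have nz: "emb_poly Q * \<alpha> + emb_poly T \<noteq> 0" "emb_poly Q \<noteq> 0" using denom_nonzero[OF *(1)] *(2) by auto
    \<comment> \<open>z is the image of infinity under the same matrix, so only the determinant
      remains in the numerator.\<close>
    have "\<beta> - z = (emb_poly Q * (emb_poly P * \<alpha> + emb_poly R) - emb_poly P * (emb_poly Q * \<alpha> + emb_poly T)) /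
        ((emb_poly Q * \<alpha> + emb_poly T) * emb_poly Q)"
      unfolding \<beta>_def mobius_def z_def diff_frac_eq[OF nz] by (simp add: mult_ac)
    also have "emb_poly Q * (emb_poly P * \<alpha> + emb_poly R) - emb_poly P * (emb_poly Q * \<alpha> + emb_poly T)
      = - emb_poly (P * T - R * Q)"
      by (simp add: emb_poly_simps algebra_simps)
    finally have "abs_inf (\<beta> - z) = 1 / ((q powi int n * q ^ e) * q powi int n)"
      unfolding *(1) by (simp add: abs_inf_divide abs_inf_mult den[OF abs_\<alpha>] absQ)
    also have "\<dots> = q powi (- (2 * int n + int e))"
      unfolding power_int_minus mult_2 powi_add power_int_of_nat by (simp add: inverse_eq_divide mult_ac)
    finally have \<beta>z: "abs_inf (\<beta> - z) = q powi (- (2 * int n + int e))" .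
    have "abs_inf (\<beta> - y) \<le> max (abs_inf (\<beta> - z)) (abs_inf (z - y))" by (rule abs_inf_triangle)
    also have "\<dots> \<le> q powi (- (2 * int L - 1))"
    proof -
      \<comment> \<open>For n = L - 1 the exponent 2n + e reaches 2L - 1 thanks to e > 0.\<close>
      have "abs_inf (\<beta> - z) \<le> q powi (- (2 * int L - 1))"
        unfolding \<beta>z powi_le_iff[OF q_gt_1] using False e_pos by linarith
      moreover have "q powi (- (int L + int n + 1)) \<le> q powi (- (2 * int L - 1))"
        unfolding powi_le_iff[OF q_gt_1] using False by linarith
      ultimately show ?thesis using zy by linarith
    qed
    finally show ?thesis using \<open>\<beta> \<in> S L\<close> unfolding cyl_iff_abs_inf q_def by blast
  qed
qed

text \<open>The summand 1 covers balls smaller than the separation scale, which contain at most one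
  fraction.\<close>

lemma finite_fractions:
  fixes x :: "'a fls"
  shows "finite (fractions_of_degree n \<inter> cyl k x)"
    "real (card (fractions_of_degree n \<inter> cyl k x)) \<le> 1 + q powi (2 * int n + 1 - k)"
proof -
  let ?E = "fractions_of_degree n \<inter> cyl k x"
  show "finite ?E"
    by (rule packing(1)[of k "max k (2 * int n + 1)" _ x])
      (use fractions_separated cyl_mono[of "2 * int n + 1" "max k (2 * int n + 1)"] in fastforce)+
  show "real (card ?E) \<le> 1 + q powi (2 * int n + 1 - k)"
  proof (cases "k \<le> 2 * int n + 1")
    case True
    then have "real (card ?E) \<le> q powi (2 * int n + 1 - k)"
      using fractions_separated by (intro packing(2)) auto
    then show ?thesis by simp
  next
    case False
    then have "?E \<subseteq> cyl (2 * int n + 1) x" using cyl_mono[of "2 * int n + 1" k x] by auto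
    then have "real (card ?E) \<le> q powi (2 * int n + 1 - (2 * int n + 1))"
      using fractions_separated by (intro packing(2)) auto
    then show ?thesis using powi_pos[of "2 * int n + 1 - k"] by (simp del: powi_pos)
  qed
qed

text \<open>Two geometric series: the summand 1 contributes at most 1/4 because L \<ge> k + 2, and
  the main count at most 1/q \<le> 1/2.\<close>

lemma bad_sum:
  assumes "k + 2 \<le> int L" "L \<ge> 1"
  shows "(\<Sum>n<L - 1. (1 + q powi (2 * int n + 1 - k)) * q powi (- (int L + int n + 1))) \<le> 3 / 4 * q powi (- k)"
proof -
  have geo1: "(\<Sum>n<m. q powi (- int n)) \<le> 2 - 2 * q powi (- int m)" for m
  proof (induction m)
    case (Suc m)
    have "2 * q powi (- int (Suc m)) \<le> q * q powi (- int (Suc m))"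
      using q_ge_2 by (intro mult_right_mono) (auto simp: less_imp_le)
    also have "\<dots> = q powi (- int m)" using powi_add[of 1 "- int (Suc m)"] by simp
    finally show ?case using Suc by simp
  qed simp
  have geo2: "(\<Sum>n<m. q powi int n) \<le> q powi int m" for m
  proof (induction m)
    case (Suc m)
    have "2 * q powi int m \<le> q * q powi int m"
      using q_ge_2 by (intro mult_right_mono) (auto simp: less_imp_le)
    also have "\<dots> = q powi int (Suc m)" using powi_add[of 1 "int m"] by simp
    finally show ?case using Suc by simp
  qed simp
  have "(\<Sum>n<L - 1. (1 + q powi (2 * int n + 1 - k)) * q powi (- (int L + int n + 1)))
    = (\<Sum>n<L - 1. q powi (- int L - 1) * q powi (- int n) + q powi (- k - int L) * q powi int n)"
  proof (rule sum.cong[OF refl])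
    fix n
    have "q powi (- (int L + int n + 1)) = q powi (- int L - 1) * q powi (- int n)"
      "q powi (2 * int n + 1 - k) * q powi (- (int L + int n + 1)) = q powi (- k - int L) * q powi int n"
      unfolding powi_add[symmetric] by (rule arg_cong[where f = "power_int q"], simp)+
    then show "(1 + q powi (2 * int n + 1 - k)) * q powi (- (int L + int n + 1)) =
      q powi (- int L - 1) * q powi (- int n) + q powi (- k - int L) * q powi int n"
      by (simp only: distrib_right mult_1)
  qed
  also have "\<dots> = q powi (- int L - 1) * (\<Sum>n<L - 1. q powi (- int n)) + q powi (- k - int L) * (\<Sum>n<L - 1. q powi int n)"
    by (simp only: sum.distrib sum_distrib_left)
  also have "\<dots> \<le> q powi (- int L - 1) * 2 + q powi (- k - int L) * q powi int (L - 1)"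
  proof (intro add_mono mult_left_mono)
    show "(\<Sum>n<L - 1. q powi (- int n)) \<le> 2"
      using geo1[of "L - 1"] powi_pos[of "- int (L - 1)"] by linarith
    show "(\<Sum>n<L - 1. q powi int n) \<le> q powi int (L - 1)" by (rule geo2)
  qed (use q_gt_1 in simp_all)
  also have "q powi (- k - int L) * q powi int (L - 1) = q powi (- k) * q powi (- 1)"
    using assms(2) unfolding powi_add[symmetric] by (simp add: of_nat_diff)
  also have "\<dots> \<le> q powi (- k) * (1 / 2)"
    using q_ge_2 by (intro mult_left_mono) (auto simp: power_int_minus field_simps)
  also have "q powi (- int L - 1) * 2 \<le> q powi (- k) * (1 / 4)"
  proof -
    have "q powi (- int L - 1) \<le> q powi (- k - 3)"
      using assms(1) q_gt_1 by (subst powi_le_iff) auto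
    also have "\<dots> = q powi (- k) * q powi (- 3)" using powi_add[of "- k" "- 3"] by simp
    also have "\<dots> \<le> q powi (- k) * (1 / 8)"
    proof (rule mult_left_mono)
      have "2 ^ 3 \<le> q ^ 3" using q_ge_2 by (intro power_mono) auto
      then show "q powi (- 3) \<le> 1 / 8" using q_gt_1 by (simp add: power_int_def field_simps)
    qed (simp add: less_imp_le)
    finally show ?thesis by simp
  qed
  finally show ?thesis by simp
qed

text \<open>By \<open>dirichlet_dichotomy\<close> the ball is covered by balls around
  \<open>S L\<close> and balls around fractions of small denominator. The latter fill at most 3/4 of
  it, so the former, each of mass M q^(1 - 2L), account for 1/4; this produces the constant 4
  q.\<close>

lemma S_ubiquity:
  assumes fin: "\<And>L k x. k \<le> 2 * int L \<Longrightarrow> finite (S L \<inter> cyl k x)"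
  shows "\<exists>L0. \<forall>L\<ge>L0. q powi (2 * int L - k) / (4 * q) \<le> real (card (S L \<inter> cyl k x))"
proof (intro exI allI impI)
  fix L :: nat assume "L \<ge> max 1 (nat (k + 2))"
  then have L: "L \<ge> 1" "k + 2 \<le> int L" by auto
  define F where "F n = fractions_of_degree n \<inter> cyl k x" for n
  have F: "finite (F n)" for n unfolding F_def by (rule finite_fractions)
  have SL: "finite (S L \<inter> cyl k x)" using L by (intro fin) auto
  define U where "U = (\<Union>\<beta>\<in>S L \<inter> cyl k x. cyl (2 * int L - 1) \<beta>)"
  define V where "V = (\<Union>n\<in>{..<L - 1}. \<Union>z\<in>F n. cyl (int L + int n + 1) z)"
  have cover: "cyl k x \<subseteq> U \<union> V"
  proof
    fix y assume y: "y \<in> cyl k x"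
    consider \<beta> where "\<beta> \<in> S L" "y \<in> cyl (2 * int L - 1) \<beta>"
      | n z where "n < L - 1" "z \<in> fractions_of_degree n" "y \<in> cyl (int L + int n + 1) z"
      using dirichlet_dichotomy[OF L(1), of y] by blast
    then show "y \<in> U \<union> V"
    proof cases
      case 1
      then have "\<beta> \<in> cyl k x" using y L cyl_subset[OF y, of "2 * int L - 1"] cyl_sym by fastforce
      with 1 show ?thesis by (auto simp: U_def)
    next
      case 2
      then have "z \<in> cyl k x" using y L cyl_subset[OF y, of "int L + int n + 1"] cyl_sym by fastforce
      with 2 show ?thesis by (auto simp: V_def F_def)
    qed
  qed
  have UV: "U \<in> fmeasurable \<mu>" "V \<in> fmeasurable \<mu>"
    unfolding U_def V_def using SL F by (intro fmeasurable.finite_UN; simp)+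
  have "M * q powi (- k) = measure \<mu> (cyl k x)" by (simp add: measure_cyl)
  also have "\<dots> \<le> measure \<mu> (U \<union> V)"
    using UV cover by (intro measure_mono_fmeasurable fmeasurable.Un) auto
  also have "\<dots> \<le> measure \<mu> U + measure \<mu> V"
    using UV by (intro measure_Un_le) auto
  also have "measure \<mu> U \<le> real (card (S L \<inter> cyl k x)) * (M * q powi (- (2 * int L - 1)))"
    unfolding U_def by (rule measure_UN_cyl_le[OF SL])
  also have "measure \<mu> V \<le> (\<Sum>n<L - 1. measure \<mu> (\<Union>z\<in>F n. cyl (int L + int n + 1) z))"
    unfolding V_def by (intro measure_UNION_le) auto
  also have "\<dots> \<le> (\<Sum>n<L - 1. M * ((1 + q powi (2 * int n + 1 - k)) * q powi (- (int L + int n + 1))))"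
  proof (rule sum_mono)
    fix n
    have "measure \<mu> (\<Union>z\<in>F n. cyl (int L + int n + 1) z) \<le> real (card (F n)) * (M * q powi (- (int L + int n + 1)))"
      by (rule measure_UN_cyl_le[OF F])
    also have "\<dots> \<le> (1 + q powi (2 * int n + 1 - k)) * (M * q powi (- (int L + int n + 1)))"
      unfolding F_def using M_pos by (intro mult_right_mono finite_fractions) (auto simp: less_imp_le)
    finally show "measure \<mu> (\<Union>z\<in>F n. cyl (int L + int n + 1) z)
      \<le> M * ((1 + q powi (2 * int n + 1 - k)) * q powi (- (int L + int n + 1)))" by (simp add: mult_ac)
  qed
  also have "\<dots> = M * (\<Sum>n<L - 1. (1 + q powi (2 * int n + 1 - k)) * q powi (- (int L + int n + 1)))"
    by (simp only: sum_distrib_left)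
  also have "\<dots> \<le> M * (3 / 4 * q powi (- k))"
    using M_pos by (intro mult_left_mono bad_sum L) auto
  finally have "M * (1 / 4 * q powi (- k)) \<le> M * (real (card (S L \<inter> cyl k x)) * q powi (- (2 * int L - 1)))"
    by (simp add: algebra_simps)
  then have 1: "1 / 4 * q powi (- k) \<le> real (card (S L \<inter> cyl k x)) * q powi (- (2 * int L - 1))"
    using M_pos by (simp only: mult_le_cancel_left_pos)
  have "q powi (2 * int L - k) / (4 * q) = q powi (2 * int L - 1) * (1 / 4 * q powi (- k))"
    using powi_add[of "2 * int L - 1" "- k"] powi_add[of 1 "2 * int L - k - 1"] q_gt_1
    by (simp add: field_simps)
  also have "\<dots> \<le> q powi (2 * int L - 1) * (real (card (S L \<inter> cyl k x)) * q powi (- (2 * int L - 1)))"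
    using 1 by (rule mult_left_mono) (simp add: less_imp_le)
  also have "\<dots> = real (card (S L \<inter> cyl k x))"
    using powi_add[of "2 * int L - 1" "- (2 * int L - 1)"] by (simp add: mult_ac)
  finally show "q powi (2 * int L - k) / (4 * q) \<le> real (card (S L \<inter> cyl k x))" .
qed

end

subsection \<open>The approximation function\<close>

text \<open>In logarithmic coordinates a factor R is a shift by ln R, so the values of \<phi> change
  at most by the factor R^L.\<close>

lemma log_lipschitz_comparable:
  fixes \<phi> :: "real \<Rightarrow> real"
  assumes pos: "\<And>t. t \<ge> 0 \<Longrightarrow> \<phi> t > 0"
    and lip: "L-lipschitz_on UNIV (\<lambda>u. ln (\<phi> (exp u)))" and R: "R \<ge> 1"
  obtains K where "K > 0"
    "\<And>s t. s > 0 \<Longrightarrow> t > 0 \<Longrightarrow> s \<le> R * t \<Longrightarrow> t \<le> R * s \<Longrightarrow> \<phi> s \<le> K * \<phi> t"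
proof (rule that[of "exp (L * ln R)"])
  fix s t :: real assume st: "s > 0" "t > 0" "s \<le> R * t" "t \<le> R * s"
  have "ln s \<le> ln (R * t)" "ln t \<le> ln (R * s)" using st R by simp_all
  then have "\<bar>ln s - ln t\<bar> \<le> ln R" using st R by (simp add: ln_mult)
  then have "L * \<bar>ln s - ln t\<bar> \<le> L * ln R"
    using lipschitz_on_nonneg[OF lip] by (rule mult_left_mono)
  moreover have "\<bar>ln (\<phi> s) - ln (\<phi> t)\<bar> \<le> L * \<bar>ln s - ln t\<bar>"
    using lipschitz_onD[OF lip, of "ln s" "ln t"] st by (simp add: dist_real_def)
  ultimately have "ln (\<phi> s) \<le> L * ln R + ln (\<phi> t)" by linarith
  then have "exp (ln (\<phi> s)) \<le> exp (L * ln R + ln (\<phi> t))" by simp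
  then show "\<phi> s \<le> exp (L * ln R) * \<phi> t" using pos st by (simp add: exp_add)
qed simp

lemma power_bracket:
  assumes "1 < (Q :: real)" "1 \<le> t"
  obtains n :: nat where "Q ^ n \<le> t" "t < Q ^ Suc n"
proof -
  obtain i where i: "Q powi (- i) \<le> t" "t < Q * Q powi (- i)"
    using exists_powi_bracket[of Q t] assms by auto
  have "Q powi 0 < Q powi (1 - i)"
    using i(2) assms power_int_add[of Q 1 "- i"] by simp
  then have "i \<le> 0" using assms by (simp only: powi_less_iff)
  then have "Q powi (- i) = Q ^ nat (- i)" by (simp add: power_int_def)
  with i show ?thesis by (intro that[of "nat (- i)"]) simp_all
qed

section \<open>Comparison of the integral with a sum over powers of Q\<close>

context
  fixes \<phi> :: "real \<Rightarrow> real" and Q K :: real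
  assumes pos: "\<And>t. t \<ge> 0 \<Longrightarrow> \<phi> t > 0" and Q: "Q > 1" and K: "K > 0"
    and comparable: "\<And>s t. s > 0 \<Longrightarrow> t > 0 \<Longrightarrow> s \<le> Q * t \<Longrightarrow> t \<le> Q * s \<Longrightarrow> \<phi> s \<le> K * \<phi> t"
begin

lemma emeasure_piece:
  "emeasure lborel {Q ^ n..<Q ^ Suc n} = ennreal (Q ^ n * (Q - 1))"
  using Q by (simp add: algebra_simps)

text \<open>A piece has length Q^n (Q - 1), so these bounds make its contribution to the integral
  comparable to \<phi>(Q^n).\<close>

lemma piece_bounds:
  assumes "t \<in> {Q ^ n..<Q ^ Suc n}"
  shows "\<phi> t / t \<le> K * \<phi> (Q ^ n) / Q ^ n" "\<phi> (Q ^ n) / (K * Q ^ Suc n) \<le> \<phi> t / t"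
proof -
  have t: "Q ^ n \<le> t" "t \<le> Q * Q ^ n" and Qn: "0 < Q ^ n" using assms Q by auto
  have t0: "t > 0" using t Qn by linarith
  have "1 * t \<le> Q * t" using Q t0 by (intro mult_right_mono) auto
  then have "Q ^ n \<le> Q * t" using t by simp
  then have c: "\<phi> t \<le> K * \<phi> (Q ^ n)" "\<phi> (Q ^ n) \<le> K * \<phi> t"
    using comparable t t0 Qn by blast+
  have p: "\<phi> t > 0" "\<phi> (Q ^ n) > 0" using pos[of t] pos[of "Q ^ n"] t0 Qn by simp_all
  show "\<phi> t / t \<le> K * \<phi> (Q ^ n) / Q ^ n"
    using c t t0 Qn p by (intro frac_le) auto
  have "\<phi> (Q ^ n) / (K * Q ^ Suc n) = (\<phi> (Q ^ n) / K) / Q ^ Suc n" by simp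
  also have "\<dots> \<le> \<phi> t / t"
    using c t t0 Qn p K by (intro frac_le) (auto simp: divide_le_eq mult.commute)
  finally show "\<phi> (Q ^ n) / (K * Q ^ Suc n) \<le> \<phi> t / t" .
qed

lemma integral_infinite_imp_not_summable:
  assumes "(\<integral>\<^sup>+t\<in>{1..}. ennreal (\<phi> t / t) \<partial>lborel) = \<infinity>"
  shows "\<not> summable (\<lambda>n. \<phi> (Q ^ n))"
proof
  assume summ: "summable (\<lambda>n. \<phi> (Q ^ n))"
  let ?g = "\<lambda>n t. ennreal (K * \<phi> (Q ^ n) / Q ^ n) * indicator {Q ^ n..<Q ^ Suc n} t"
  have Qn: "\<phi> (Q ^ n) > 0" "Q ^ n > 0" for n using pos[of "Q ^ n"] Q by auto
  have "(\<integral>\<^sup>+t\<in>{1..}. ennreal (\<phi> t / t) \<partial>lborel) \<le> (\<integral>\<^sup>+t. (\<Sum>n. ?g n t) \<partial>lborel)"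
  proof (rule nn_integral_mono)
    fix t :: real
    show "ennreal (\<phi> t / t) * indicator {1..} t \<le> (\<Sum>n. ?g n t)"
    proof (cases "t \<ge> 1")
      case True
      obtain n where n: "Q ^ n \<le> t" "t < Q ^ Suc n" by (rule power_bracket[OF Q True])
      then have "ennreal (\<phi> t / t) * indicator {1..} t \<le> ?g n t"
        using piece_bounds(1)[of t n] True by (simp add: ennreal_leI)
      also have "\<dots> = sum (\<lambda>i. ?g i t) {n}"
        using sum.insert[of "{}" n "\<lambda>i. ?g i t"]
        by (simp only: finite.emptyI sum.empty add_0_right empty_iff not_False_eq_True)
      also have "\<dots> \<le> (\<Sum>n. ?g n t)" by (rule sum_le_suminf) auto
      finally show ?thesis .
    qed simp
  qed
  also have "\<dots> = (\<Sum>n. \<integral>\<^sup>+t. ?g n t \<partial>lborel)" by (rule nn_integral_suminf) measurable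
  also have "\<dots> = (\<Sum>n. ennreal (K * (Q - 1) * \<phi> (Q ^ n)))"
  proof (rule suminf_cong)
    fix n
    have "(\<integral>\<^sup>+t. ?g n t \<partial>lborel) = ennreal (K * \<phi> (Q ^ n) / Q ^ n) * ennreal (Q ^ n * (Q - 1))"
      by (subst nn_integral_cmult_indicator) (simp_all only: emeasure_piece sets_lborel atLeastLessThan_borel)
    also have "\<dots> = ennreal (K * \<phi> (Q ^ n) / Q ^ n * (Q ^ n * (Q - 1)))"
      using K Q Qn[of n] by (intro ennreal_mult[symmetric]) auto
    also have "K * \<phi> (Q ^ n) / Q ^ n * (Q ^ n * (Q - 1)) = K * (Q - 1) * \<phi> (Q ^ n)"
      using Q by simp
    finally show "(\<integral>\<^sup>+t. ?g n t \<partial>lborel) = ennreal (K * (Q - 1) * \<phi> (Q ^ n))" .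
  qed
  also have "\<dots> = ennreal (\<Sum>n. K * (Q - 1) * \<phi> (Q ^ n))"
    using K Q Qn by (intro suminf_ennreal2 summable_mult summ) (auto simp: less_imp_le)
  also have "\<dots> < \<infinity>" by simp
  finally show False using assms by simp
qed

lemma integral_finite_imp_summable:
  assumes "(\<integral>\<^sup>+t\<in>{1..}. ennreal (\<phi> t / t) \<partial>lborel) < \<infinity>"
  shows "summable (\<lambda>n. \<phi> (Q ^ n))"
proof -
  let ?I = "\<integral>\<^sup>+t\<in>{1..}. ennreal (\<phi> t / t) \<partial>lborel"
  let ?g = "\<lambda>n t. ennreal (\<phi> (Q ^ n) / (K * Q ^ Suc n)) * indicator {Q ^ n..<Q ^ Suc n} t"
  have Qn: "\<phi> (Q ^ n) > 0" "Q ^ n > 0" for n using pos[of "Q ^ n"] Q by auto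
  define c where "c = (Q - 1) / (K * Q)"
  have c: "c > 0" using K Q by (simp add: c_def)
  have int_g: "(\<integral>\<^sup>+t. ?g n t \<partial>lborel) = ennreal (c * \<phi> (Q ^ n))" for n
  proof -
    have "(\<integral>\<^sup>+t. ?g n t \<partial>lborel) = ennreal (\<phi> (Q ^ n) / (K * Q ^ Suc n)) * ennreal (Q ^ n * (Q - 1))"
      by (subst nn_integral_cmult_indicator) (simp_all only: emeasure_piece sets_lborel atLeastLessThan_borel)
    also have "\<dots> = ennreal (\<phi> (Q ^ n) / (K * Q ^ Suc n) * (Q ^ n * (Q - 1)))"
      using K Q Qn[of n] by (intro ennreal_mult[symmetric]) auto
    also have "\<phi> (Q ^ n) / (K * Q ^ Suc n) * (Q ^ n * (Q - 1)) = c * \<phi> (Q ^ n)"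
      using Q K by (simp add: c_def field_simps)
    finally show ?thesis .
  qed
  have "c * (\<Sum>n<m. \<phi> (Q ^ n)) \<le> enn2real ?I" for m
  proof -
    have "ennreal (c * (\<Sum>n<m. \<phi> (Q ^ n))) = (\<Sum>n<m. ennreal (c * \<phi> (Q ^ n)))"
      unfolding sum_distrib_left using c Qn by (intro sum_ennreal[symmetric]) (auto simp: less_imp_le)
    also have "\<dots> = (\<integral>\<^sup>+t. (\<Sum>n<m. ?g n t) \<partial>lborel)"
      unfolding int_g[symmetric] by (rule nn_integral_sum[symmetric]) measurable
    also have "\<dots> \<le> ?I"
    proof (rule nn_integral_mono)
      fix t :: real
      show "(\<Sum>n<m. ?g n t) \<le> ennreal (\<phi> t / t) * indicator {1..} t"
      proof (cases "t \<ge> 1")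
        case True
        obtain n where n: "Q ^ n \<le> t" "t < Q ^ Suc n" by (rule power_bracket[OF Q True])
        \<comment> \<open>The pieces are disjoint, so at most one term of the sum survives at
          t.\<close>
        have "i = n" if "Q ^ i \<le> t" "t < Q ^ Suc i" for i
        proof -
          have "Q ^ i < Q ^ Suc n" "Q ^ n < Q ^ Suc i" using that n by linarith+
          then show ?thesis using Q by (simp only: power_strict_increasing_iff)
        qed
        then have "(\<Sum>i<m. ?g i t) = (\<Sum>i<m. if n = i then ?g n t else 0)"
          by (intro sum.cong refl) (auto simp: indicator_def)
        also have "\<dots> \<le> ?g n t" by simp
        also have "\<dots> \<le> ennreal (\<phi> t / t) * indicator {1..} t"
          using piece_bounds(2)[of t n] True n by (simp add: ennreal_leI)
        finally show ?thesis .
      next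
        case False
        have "t < Q ^ i" for i using False one_le_power[of Q i] Q by linarith
        then have "?g i t = 0" for i by (simp add: indicator_def not_le)
        then have "(\<Sum>n<m. ?g n t) = 0" by (intro sum.neutral ballI)
        then show ?thesis by (simp only: zero_le)
      qed
    qed
    finally have "ennreal (c * (\<Sum>n<m. \<phi> (Q ^ n))) \<le> ?I" .
    then have "enn2real (ennreal (c * (\<Sum>n<m. \<phi> (Q ^ n)))) \<le> enn2real ?I"
      using assms by (intro enn2real_mono) simp_all
    moreover have "0 \<le> c * (\<Sum>n<m. \<phi> (Q ^ n))"
      using c Qn by (intro mult_nonneg_nonneg sum_nonneg) (auto simp: less_imp_le)
    ultimately show ?thesis by simp
  qed
  then have "(\<Sum>n<m. \<phi> (Q ^ n)) \<le> enn2real ?I / c" for m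
    using c by (simp add: le_divide_eq mult.commute)
  then show ?thesis
    using Qn by (intro summableI_nonneg_bounded) (auto simp: less_imp_le)
qed

end

subsection \<open>Existence of a quadratic irrational\<close>

text \<open>The generating function of the Catalan numbers at $X^{-1}$ is a root of $Y^2 - XY + X$.\<close>

fun catalan :: "nat \<Rightarrow> 'a::comm_ring_1" where
  "catalan n = (if n = 0 then 1 else \<Sum>i<n. catalan i * catalan (n - 1 - i))"

declare catalan.simps [simp del]

lemma catalan_equation: "(Abs_fps catalan :: 'a::comm_ring_1 fps) = 1 + fps_X * (Abs_fps catalan * Abs_fps catalan)"
proof (rule fps_ext)
  fix n
  show "fps_nth (Abs_fps catalan :: 'a fps) n = fps_nth (1 + fps_X * (Abs_fps catalan * Abs_fps catalan)) n"
  proof (cases n)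
    case (Suc k)
    have "(catalan (Suc k) :: 'a) = (\<Sum>i\<le>k. catalan i * catalan (k - i))"
      by (subst catalan.simps) (simp add: lessThan_Suc_atMost)
    then show ?thesis by (simp add: Suc fps_mult_nth[of "Abs_fps catalan"] atLeast0AtMost)
  qed (simp add: catalan.simps)
qed

text \<open>Infinite descent for Y^2 - XY + X at Y = p/r. Setting X = 0 shows that X divides p;
  after cancelling, it shows that X divides r, and the two quotients satisfy the same
  equation.\<close>

lemma no_rational_root:
  fixes p r :: "'a::field poly"
  assumes "p * p + [:0, 1:] * r * r = [:0, 1:] * p * r"
  shows "r = 0"
  using assms
proof (induction "degree r" arbitrary: p r rule: less_induct)
  case less
  show ?case
  proof (rule ccontr)
    assume r: "r \<noteq> 0"
    obtain a p' where p': "p = pCons a p'" by (cases p)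
    have "poly (p * p + [:0, 1:] * r * r) 0 = poly ([:0, 1:] * p * r) 0" using less.prems by simp
    then have "a = 0" by (simp add: p')
    then have px: "p = [:0, 1:] * p'" by (simp add: p')
    have "[:0, 1:] * ([:0, 1:] * p' * p' + r * r) = [:0, 1:] * ([:0, 1:] * p' * r)"
      using less.prems unfolding px by (simp only: algebra_simps)
    then have eq: "[:0, 1:] * p' * p' + r * r = [:0, 1:] * p' * r"
      by (simp only: mult_cancel_left) simp
    obtain b r' where r': "r = pCons b r'" by (cases r)
    have "poly ([:0, 1:] * p' * p' + r * r) 0 = poly ([:0, 1:] * p' * r) 0" using eq by simp
    then have "b = 0" by (simp add: r')
    then have rx: "r = [:0, 1:] * r'" by (simp add: r')
    have "[:0, 1:] * (p' * p' + [:0, 1:] * r' * r') = [:0, 1:] * ([:0, 1:] * p' * r')"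
      using eq unfolding rx by (simp only: algebra_simps)
    then have "p' * p' + [:0, 1:] * r' * r' = [:0, 1:] * p' * r'"
      by (simp only: mult_cancel_left) simp
    moreover have "r' \<noteq> 0" using r rx by auto
    moreover have "degree r' < degree r" using \<open>r' \<noteq> 0\<close> \<open>b = 0\<close> by (simp add: r')
    ultimately show False using less.hyps by blast
  qed
qed

text \<open>The convergent half asserts the existence of a class, so a quadratic irrational has to
  be exhibited in every characteristic, including two.\<close>

lemma quad_irr_nonempty: "\<exists>\<alpha> :: 'a::field fls. \<alpha> \<in> quad_irr"
proof -
  define \<gamma> :: "'a fls" where "\<gamma> = fps_to_fls (Abs_fps catalan)"
  define X where "X = emb_poly [:0, 1 :: 'a:]"
  have X: "X = fls_X_inv" by (simp add: X_def emb_poly_pCons)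
  have "\<gamma> = 1 + fls_X * (\<gamma> * \<gamma>)"
    unfolding \<gamma>_def by (subst catalan_equation) (simp add: fls_times_fps_to_fls fps_X_to_fls)
  then have "X * \<gamma> = X * (1 + fls_X * (\<gamma> * \<gamma>))" by simp
  also have "\<dots> = X + (fls_X_inv * fls_X) * (\<gamma> * \<gamma>)" by (simp add: X algebra_simps)
  also have "fls_X_inv * fls_X = (1 :: 'a fls)" by (simp add: fls_X_inv_times_conv_shift)
  finally have eq: "X * \<gamma> = X + \<gamma> * \<gamma>" by simp
  have "\<gamma> \<notin> rat_fls"
  proof
    assume "\<gamma> \<in> rat_fls"
    then obtain p r where pr: "\<gamma> = emb_poly p / emb_poly r" "r \<noteq> 0" by (auto simp: rat_fls_def)
    then have p: "emb_poly p = \<gamma> * emb_poly r" by simp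
    have "emb_poly (p * p + [:0, 1:] * r * r) = (X + \<gamma> * \<gamma>) * (emb_poly r * emb_poly r)"
      unfolding emb_poly_add emb_poly_mult p X_def[symmetric] by (simp add: algebra_simps)
    also have "\<dots> = emb_poly ([:0, 1:] * p * r)"
      unfolding eq[symmetric] emb_poly_mult p X_def[symmetric] by (simp add: algebra_simps)
    finally have "p * p + [:0, 1:] * r * r = [:0, 1:] * p * r" by (simp only: emb_poly_inj)
    then show False using no_rational_root pr(2) by blast
  qed
  moreover have "1 * \<gamma>\<^sup>2 + (- X) * \<gamma> + X = 0" using eq by (simp add: power2_eq_square)
  moreover have "X \<in> rat_fls" "- X \<in> rat_fls" by (auto simp: X_def intro: rat_fls_uminus)
  ultimately have "\<gamma> \<in> quad_irr"
    unfolding quad_irr_def mem_Collect_eq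
    by (intro conjI bexI[of _ 1] bexI[of _ "- X"] bexI[of _ X]) simp_all
  then show ?thesis ..
qed

subsection \<open>The lower limit\<close>

lemma approx_liminf_eq_top:
  assumes "\<And>m::nat. \<exists>H. \<forall>\<beta>\<in>C. height \<beta> \<ge> H \<longrightarrow> real m \<le> height \<beta> / \<phi> (height \<beta>) * abs_inf (x - \<beta>)"
  shows "approx_liminf \<phi> C x = \<infinity>"
proof (rule ereal_top)
  fix B :: real
  obtain m :: nat where m: "B \<le> real m" using real_arch_simple by blast
  obtain H where H: "\<forall>\<beta>\<in>C. height \<beta> \<ge> H \<longrightarrow> real m \<le> height \<beta> / \<phi> (height \<beta>) * abs_inf (x - \<beta>)"
    using assms by blast
  show "ereal B \<le> approx_liminf \<phi> C x"
    unfolding approx_liminf_def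
  proof (rule Liminf_bounded)
    show "\<forall>\<^sub>F \<beta> in inf (filtercomap height at_top) (principal C).
      ereal B \<le> ereal (height \<beta> / \<phi> (height \<beta>) * abs_inf (x - \<beta>))"
      unfolding eventually_inf_principal eventually_filtercomap_at_top_linorder
      using H m by (force intro: exI[of _ H])
  qed
qed

text \<open>Asking for witnesses above every H also rules out the trivial filter, whose lower limit
  would be infinite.\<close>

lemma approx_liminf_eq_0:
  assumes pos: "\<And>t. t \<ge> 0 \<Longrightarrow> \<phi> t > 0"
    and "\<And>\<epsilon> H. \<epsilon> > 0 \<Longrightarrow> \<exists>\<beta>\<in>C. height \<beta> \<ge> H \<and> height \<beta> / \<phi> (height \<beta>) * abs_inf (x - \<beta>) \<le> \<epsilon>"
  shows "approx_liminf \<phi> C x = 0"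
proof (rule antisym)
  have h: "height \<beta> \<ge> 0" for \<beta> :: "'a fls" by (simp add: height_def)
  show "0 \<le> approx_liminf \<phi> C x"
    unfolding approx_liminf_def
    using pos h by (intro Liminf_bounded always_eventually allI) (simp add: less_imp_le)
  show "approx_liminf \<phi> C x \<le> 0"
  proof (rule ccontr)
    assume "\<not> approx_liminf \<phi> C x \<le> 0"
    then have "0 < approx_liminf \<phi> C x" by simp
    then obtain \<epsilon> where \<epsilon>: "0 < ereal \<epsilon>" "ereal \<epsilon> < approx_liminf \<phi> C x"
      using ereal_dense2 by blast
    from less_LiminfD[OF \<epsilon>(2)[unfolded approx_liminf_def]]
    obtain H where H: "\<And>\<beta>. height \<beta> \<ge> H \<Longrightarrow> \<beta> \<in> C \<Longrightarrow> \<epsilon> < height \<beta> / \<phi> (height \<beta>) * abs_inf (x - \<beta>)"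
      unfolding eventually_inf_principal eventually_filtercomap_at_top_linorder by auto
    obtain \<beta> where "\<beta> \<in> C" "height \<beta> \<ge> H" "height \<beta> / \<phi> (height \<beta>) * abs_inf (x - \<beta>) \<le> \<epsilon>"
      using assms(2)[of \<epsilon> H] \<epsilon>(1) by auto
    then show False using H by fastforce
  qed
qed

subsection \<open>Convergence and divergence\<close>

lemma (in quadratic_pair) height_powi:
  assumes "\<beta> \<in> congruence_class \<alpha>"
  obtains i where "height \<beta> = real CARD('a) powi i"
proof -
  have "abs_inf (\<beta> - galois_conj \<beta>) \<noteq> 0" using height_pos[OF assms] by (auto simp: height_def)
  then obtain k where "abs_inf (\<beta> - galois_conj \<beta>) = real CARD('a) powi (- k)"
    using abs_inf_eq_powi by (metis abs_inf_eq_0_iff)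
  then show ?thesis by (intro that[of k]) (simp add: height_def power_int_minus)
qed

text \<open>Restates \<open>separation\<close> for balls, uniformly in m: the offset j absorbs the
  constant \<kappa> / c.\<close>

lemma (in quadratic_pair) separation_cyl:
  fixes q :: real
  defines "q \<equiv> real CARD('a)"
  assumes "c > 0"
  obtains j :: nat where "\<And>m \<beta> \<beta>'. \<beta> \<in> congruence_class \<alpha> \<Longrightarrow> \<beta>' \<in> congruence_class \<alpha> \<Longrightarrow> \<beta> \<noteq> \<beta>' \<Longrightarrow>
    height \<beta> \<le> c * q powi m \<Longrightarrow> height \<beta>' \<le> c * q powi m \<Longrightarrow> \<beta>' \<notin> cyl (m + int j) \<beta>"
proof -
  have q: "q > 1" using card_field_gt_1[where 'a='a] by (simp add: q_def)
  obtain \<kappa> where \<kappa>: "\<kappa> > 0" "\<And>\<beta> \<beta>'. \<beta> \<in> congruence_class \<alpha> \<Longrightarrow> \<beta>' \<in> congruence_class \<alpha> \<Longrightarrow> \<beta> \<noteq> \<beta>' \<Longrightarrow>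
      height \<beta> \<le> height \<beta>' \<Longrightarrow> abs_inf (\<beta> - \<beta>') \<ge> \<kappa> / height \<beta>'"
    using separation by metis
  obtain j :: nat where j: "q powi (- int j) < \<kappa> / c"
    using exists_powi_less[OF q, of "\<kappa> / c"] \<kappa>(1) assms by auto
  show ?thesis
  proof (rule that)
    fix m \<beta> \<beta>' assume *: "\<beta> \<in> congruence_class \<alpha>" "\<beta>' \<in> congruence_class \<alpha>" "\<beta> \<noteq> \<beta>'"
      "height \<beta> \<le> c * q powi m" "height \<beta>' \<le> c * q powi m"
    have mono: "\<kappa> / (c * q powi m) \<le> \<kappa> / h" if "h > 0" "h \<le> c * q powi m" for h
      using that \<kappa>(1) assms by (intro divide_left_mono) auto
    have "q powi (- (m + int j)) = q powi (- int j) / q powi m"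
    proof -
      have "- (m + int j) = - int j - m" "q \<noteq> 0" using q by auto
      then show ?thesis by (simp only: power_int_diff simp_thms)
    qed
    also have "\<dots> < (\<kappa> / c) / q powi m"
      using j q by (intro divide_strict_right_mono) auto
    also have "\<dots> = \<kappa> / (c * q powi m)" by simp
    also have "\<dots> \<le> abs_inf (\<beta> - \<beta>')"
    proof (cases "height \<beta> \<le> height \<beta>'")
      case True
      then show ?thesis
        using \<kappa>(2)[OF *(1-3)] mono[OF height_pos[OF *(2)] *(5)] by linarith
    next
      case False
      then show ?thesis
        using \<kappa>(2)[OF *(2,1)] *(3) mono[OF height_pos[OF *(1)] *(4)]
        by (simp add: abs_inf_diff_commute[of \<beta> \<beta>'])
    qed
    finally show "\<beta>' \<notin> cyl (m + int j) \<beta>"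
      unfolding cyl_iff_abs_inf q_def by linarith
  qed
qed

text \<open>The new coefficients come from substituting Y - p for Y in A Y^2 + B Y + C.\<close>

lemma quadratic_pair_translate:
  assumes "quadratic_pair \<alpha> \<alpha>' A B C"
  shows "quadratic_pair (\<alpha> + emb_poly p) (\<alpha>' + emb_poly p) A (B - (p + p) * A) (C - p * B + p * p * A)"
proof -
  interpret quadratic_pair \<alpha> \<alpha>' A B C by fact
  show ?thesis
  proof
    show "\<alpha> + emb_poly p \<notin> rat_fls"
      using irrational rat_fls_diff[OF _ rat_fls_emb[of p], of "\<alpha> + emb_poly p"] by auto
    have B: "emb_poly B = - (emb_poly A * (\<alpha> + \<alpha>'))" using trace by simp
    show "emb_poly A * (\<alpha> + emb_poly p + (\<alpha>' + emb_poly p)) = - emb_poly (B - (p + p) * A)"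
      unfolding emb_poly_simps B by (simp add: algebra_simps)
    show "emb_poly A * ((\<alpha> + emb_poly p) * (\<alpha>' + emb_poly p)) = emb_poly (C - p * B + p * p * A)"
      unfolding emb_poly_simps B norm[symmetric] by (simp add: algebra_simps)
  qed (rule A_nonzero)
qed

text \<open>Translation by p is a matrix of determinant 1; approximants found for the translate thus
  belong to the original class.\<close>

lemma congruence_class_translate:
  "congruence_class (\<alpha> + emb_poly p) \<subseteq> congruence_class \<alpha>"
proof
  fix \<beta> assume "\<beta> \<in> congruence_class (\<alpha> + emb_poly p)"
  then obtain a b c d where *: "\<beta> = mobius a b c d (\<alpha> + emb_poly p)" "a * d - b * c = 1"
    by (auto simp: congruence_class_eq)
  have "\<beta> = mobius a (a * p + b) c (c * p + d) \<alpha>"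
    unfolding *(1) mobius_def by (simp add: emb_poly_simps algebra_simps)
  moreover have "a * (c * p + d) - (a * p + b) * c = 1" using *(2) by (simp add: algebra_simps)
  ultimately show "\<beta> \<in> congruence_class \<alpha>" unfolding congruence_class_eq by blast
qed

section \<open>The convergent half\<close>

context haar_fls
begin

text \<open>For each m, take balls of radius about (m + 1) \<phi>(q^n) / q^n around the elements of
  height q^n. Outside them the quantity in the lower limit exceeds m, and their total mass in a
  fixed ball is bounded by a multiple of the sum of \<phi>(q^n). Countably many m suffice.\<close>

theorem convergent_case:
  assumes pos: "\<And>t. t \<ge> 0 \<Longrightarrow> \<phi> t > 0" and summ: "summable (\<lambda>n. \<phi> (q ^ n))"
    and \<alpha>: "\<alpha> \<in> quad_irr"
  shows "AE x in \<mu>. approx_liminf \<phi> (congruence_class \<alpha>) x = \<infinity>"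
proof -
  obtain A B C where "quadratic_pair \<alpha> (galois_conj \<alpha>) A B C" using quad_irr_pair[OF \<alpha>] .
  then interpret quadratic_pair \<alpha> "galois_conj \<alpha>" A B C .
  obtain j :: nat where j: "\<And>m \<beta> \<beta>'. \<beta> \<in> congruence_class \<alpha> \<Longrightarrow> \<beta>' \<in> congruence_class \<alpha> \<Longrightarrow> \<beta> \<noteq> \<beta>' \<Longrightarrow>
    height \<beta> \<le> 1 * q powi m \<Longrightarrow> height \<beta>' \<le> 1 * q powi m \<Longrightarrow> \<beta>' \<notin> cyl (m + int j) \<beta>"
    using separation_cyl[of 1] unfolding q_def by (metis zero_less_one)
  define S where "S n = {\<beta> \<in> congruence_class \<alpha>. height \<beta> = q ^ n}" for n
  have "AE x in \<mu>. \<exists>H. \<forall>\<beta>\<in>congruence_class \<alpha>. height \<beta> \<ge> H \<longrightarrow>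
      real m \<le> height \<beta> / \<phi> (height \<beta>) * abs_inf (x - \<beta>)" for m
  proof -
    \<comment> \<open>\<open>Suc m\<close> keeps the radius positive for m = 0.\<close>
    define e where "e n = real (Suc m) * \<phi> (q ^ n) / q ^ n" for n
    have qn: "q ^ n > 0" "\<phi> (q ^ n) > 0" for n using pos[of "q ^ n"] q_gt_1 by auto
    have "e n > 0" for n using qn by (simp add: e_def)
    then have "\<exists>i. q powi (- i) \<le> e n \<and> e n < q * q powi (- i)" for n
      using exists_powi_bracket[OF q_gt_1, of "e n"] by metis
    then obtain i where i: "\<And>n. q powi (- i n) \<le> e n" "\<And>n. e n < q * q powi (- i n)" by metis
    \<comment> \<open>Subtracting 1 rounds the radius up, so that a point outside the ball is at
      distance more than \<open>e n\<close>.\<close>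
    define \<rho> where "\<rho> n = i n - 1" for n
    have \<rho>: "q powi (- \<rho> n) = q * q powi (- i n)" for n
      using powi_add[of 1 "- i n"] by (simp add: \<rho>_def)
    have "AE x in \<mu>. \<forall>\<^sub>F n in sequentially. \<forall>\<beta>\<in>S n. x \<notin> cyl (\<rho> n) \<beta>"
    proof (rule AE_eventually_avoids)
      show "\<beta>' \<notin> cyl (int n + int j) \<beta>" if "\<beta> \<in> S n" "\<beta>' \<in> S n" "\<beta> \<noteq> \<beta>'" for n \<beta> \<beta>'
        using that by (intro j) (auto simp: S_def)
      show "summable (\<lambda>n. q powi (int n - \<rho> n))"
      proof (rule summable_comparison_test'[where N = 0])
        show "summable (\<lambda>n. q * real (Suc m) * \<phi> (q ^ n))" by (intro summable_mult summ)
        fix n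
        have "q powi (int n - \<rho> n) = q ^ n * (q * q powi (- i n))"
          using powi_add[of "int n" "- \<rho> n"] by (simp only: \<rho> power_int_of_nat add_uminus_conv_diff)
        also have "\<dots> \<le> q ^ n * (q * e n)" using i(1) q_gt_1 by (intro mult_left_mono) auto
        also have "\<dots> = q * real (Suc m) * \<phi> (q ^ n)" using qn[of n] by (simp add: e_def)
        finally show "norm (q powi (int n - \<rho> n)) \<le> q * real (Suc m) * \<phi> (q ^ n)"
          by (simp only: real_norm_def abs_of_pos powi_pos)
      qed
    qed
    then show ?thesis
    proof eventually_elim
      case (elim x)
      then obtain N where N: "\<And>n \<beta>. n \<ge> N \<Longrightarrow> \<beta> \<in> S n \<Longrightarrow> x \<notin> cyl (\<rho> n) \<beta>"
        unfolding eventually_sequentially by blast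
      have "real m \<le> height \<beta> / \<phi> (height \<beta>) * abs_inf (x - \<beta>)"
        if \<beta>: "\<beta> \<in> congruence_class \<alpha>" "height \<beta> \<ge> q ^ N" for \<beta>
      proof -
        obtain l where l: "height \<beta> = q powi l" using height_powi[OF \<beta>(1)] unfolding q_def .
        have "q powi int N \<le> q powi l" using \<beta>(2) l by simp
        then have "int N \<le> l" by (simp only: powi_le_iff[OF q_gt_1])
        then obtain n where n: "l = int n" "n \<ge> N" by (metis nonneg_int_cases of_nat_0_le_iff of_nat_le_iff order_trans)
        have h: "height \<beta> = q ^ n" using l n by simp
        then have "x \<notin> cyl (\<rho> n) \<beta>" using N n \<beta>(1) by (auto simp: S_def)
        then have "q powi (- \<rho> n) < abs_inf (x - \<beta>)"
          unfolding cyl_iff_abs_inf q_def[symmetric] by (simp add: abs_inf_diff_commute)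
        then have "e n < abs_inf (x - \<beta>)" using i(2)[of n] \<rho>[of n] by linarith
        then have "height \<beta> / \<phi> (height \<beta>) * e n \<le> height \<beta> / \<phi> (height \<beta>) * abs_inf (x - \<beta>)"
          unfolding h using qn[of n] by (intro mult_left_mono) auto
        moreover have "height \<beta> / \<phi> (height \<beta>) * e n = real (Suc m)"
          using qn[of n] q_gt_1 by (simp add: e_def h)
        ultimately show ?thesis by simp
      qed
      then show ?case by blast
    qed
  qed
  then have "AE x in \<mu>. \<forall>m::nat. \<exists>H. \<forall>\<beta>\<in>congruence_class \<alpha>. height \<beta> \<ge> H \<longrightarrow>
      real m \<le> height \<beta> / \<phi> (height \<beta>) * abs_inf (x - \<beta>)"
    by (subst AE_all_countable) blast
  then show ?thesis
    by eventually_elim (intro approx_liminf_eq_top, blast)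
qed

end

section \<open>The divergent half\<close>

context balanced_pair
begin

text \<open>The targets have radius about \<open>\<tau> N\<close> q^(-4N), with
  \<open>\<tau> N\<close> a capped multiple of \<phi>(q^(4N)), so that hitting one gives the
  required inequality for \<epsilon>.\<close>

lemma AE_good_approximations:
  assumes pos: "\<And>t. t \<ge> 0 \<Longrightarrow> \<phi> t > 0" and lip: "l-lipschitz_on UNIV (\<lambda>u. ln (\<phi> (exp u)))"
    and nsumm: "\<not> summable (\<lambda>N. \<phi> ((q ^ 4) ^ N))" and \<epsilon>: "\<epsilon> > 0"
  shows "AE x in \<mu>. \<forall>H. \<exists>\<beta>\<in>congruence_class \<alpha>. height \<beta> \<ge> H \<and>
    height \<beta> / \<phi> (height \<beta>) * abs_inf (x - \<beta>) \<le> \<epsilon>"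
proof -
  obtain j :: nat where j: "\<And>m \<beta> \<beta>'. \<beta> \<in> congruence_class \<alpha> \<Longrightarrow> \<beta>' \<in> congruence_class \<alpha> \<Longrightarrow> \<beta> \<noteq> \<beta>' \<Longrightarrow>
    height \<beta> \<le> c0 * q powi m \<Longrightarrow> height \<beta>' \<le> c0 * q powi m \<Longrightarrow> \<beta>' \<notin> cyl (m + int j) \<beta>"
    using separation_cyl[OF c0_pos] unfolding q_def by metis
  have S_sep: "\<beta>' \<notin> cyl (2 * int L' + int j) \<beta>"
    if "L \<le> L'" "\<beta> \<in> S L" "\<beta>' \<in> S L'" "\<beta> \<noteq> \<beta>'" for L L' \<beta> \<beta>'
  proof (rule j)
    have "c0 * q powi (2 * int L) \<le> c0 * q powi (2 * int L')"
      using that(1) c0_pos q_gt_1 by (simp add: powi_le_iff)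
    then show "height \<beta> \<le> c0 * q powi (2 * int L')" using that(2) by (auto simp: S_def)
  qed (use that in \<open>auto simp: S_def\<close>)
  have S_fin: "finite (S L \<inter> cyl k x)" if "k \<le> 2 * int L" for L k x
    using that S_sep[of L L] by (intro packing(1)[of k "2 * int L + int j" _ x]) auto
  \<comment> \<open>An element of \<open>S (2 * N)\<close> has height between c0 q^(4N) / q^2 and c0
    q^(4N); R bounds the ratio to q^(4N) both ways.\<close>
  define R where "R = max 1 (max c0 (q\<^sup>2 / c0))"
  have R: "R \<ge> 1" "c0 \<le> R" "q\<^sup>2 \<le> R * c0"
    using c0_pos by (auto simp: R_def max_mult_distrib_right)
  obtain K where K: "K > 0" "\<And>s t. s > 0 \<Longrightarrow> t > 0 \<Longrightarrow> s \<le> R * t \<Longrightarrow> t \<le> R * s \<Longrightarrow> \<phi> s \<le> K * \<phi> t"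
    using log_lipschitz_comparable[OF pos lip R(1)] by metis
  define \<Phi> where "\<Phi> N = \<phi> ((q ^ 4) ^ N)" for N
  have \<Phi>_pos: "\<Phi> N > 0" for N using pos[of "(q ^ 4) ^ N"] q_gt_1 by (simp add: \<Phi>_def)
  define \<eta> where "\<eta> = 1 / (4 * (4 * q) * q powi (2 * int j))"
  \<comment> \<open>The cap yields both size conditions of \<open>target_system\<close>: weights at
    most \<eta>, and radii at most the separation scale.\<close>
  define \<eta>' where "\<eta>' = min \<eta> (q powi (- int j))"
  have \<eta>': "\<eta>' > 0" using q_gt_1 by (simp add: \<eta>'_def \<eta>_def)
  \<comment> \<open>Cancels the constants c0, from the height, and K, from comparing values of
    \<phi>, in the final estimate.\<close>
  define b where "b = \<epsilon> / (K * c0)"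
  have b: "b > 0" using \<epsilon> K(1) c0_pos by (simp add: b_def)
  define \<tau> where "\<tau> N = min (b * \<Phi> N) \<eta>'" for N
  have "\<tau> N > 0" for N using b \<Phi>_pos \<eta>' by (simp add: \<tau>_def)
  then have "\<exists>i. q powi (- i) \<le> \<tau> N \<and> \<tau> N < q * q powi (- i)" for N
    using exists_powi_bracket[OF q_gt_1, of "\<tau> N"] by metis
  then obtain i where i: "\<And>N. q powi (- i N) \<le> \<tau> N" "\<And>N. \<tau> N < q * q powi (- i N)" by metis
  define \<rho> where "\<rho> N = 4 * int N + i N" for N
  \<comment> \<open>Capping preserves divergence: summable weights would tend to 0, making the cap
    eventually inactive.\<close>
  have not_summable: "\<not> summable (\<lambda>N. q powi (- i N))"
  proof
    assume "summable (\<lambda>N. q powi (- i N))"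
    then have "summable (\<lambda>N. q * q powi (- i N))" by (rule summable_mult)
    then have summ: "summable \<tau>"
      by (rule summable_comparison_test'[where N = 0])
        (use i(2) \<open>\<And>N. \<tau> N > 0\<close> in \<open>simp add: less_imp_le\<close>)
    have "\<forall>\<^sub>F N in sequentially. \<tau> N < \<eta>'"
      by (rule order_tendstoD(2)[OF summable_LIMSEQ_zero[OF summ] \<eta>'])
    then have "\<forall>\<^sub>F N in sequentially. \<tau> N = b * \<Phi> N"
      by eventually_elim (auto simp: \<tau>_def min_def split: if_splits)
    then have "summable \<tau> = summable (\<lambda>N. b * \<Phi> N)" by (rule summable_cong)
    with summ have "summable (\<lambda>N. b * \<Phi> N)" by simp
    then have "summable \<Phi>" using b by (simp add: summable_cmult_iff)
    then show False using nsumm unfolding \<Phi>_def by simp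
  qed
  \<comment> \<open>Only even indices occur, as \<open>S L\<close> and \<open>S (L + 1)\<close> both
    admit the height c0 q^(2L). The constant 4 q is that of \<open>S_ubiquity\<close>.\<close>
  interpret T: target_system \<mu> M q "\<lambda>N. S (2 * N)" \<rho> "int j" "4 * q" \<eta>
  proof
    show "4 * q > 0" using q_gt_1 by simp
    show "\<eta> = 1 / (4 * (4 * q) * q powi (2 * int j))" by (simp add: \<eta>_def)
    show "\<beta>' \<notin> cyl (4 * int N' + int j) \<beta>"
      if "N \<le> N'" "\<beta> \<in> S (2 * N)" "\<beta>' \<in> S (2 * N')" "\<beta> \<noteq> \<beta>'" for N N' \<beta> \<beta>'
      using S_sep[of "2 * N" "2 * N'" \<beta> \<beta>'] that by simp
    show "S (2 * N) \<inter> S (2 * N') = {}" if "N \<noteq> N'" for N N'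
    proof -
      have "S (2 * N) \<inter> S (2 * N') = {}" if "N < N'" for N N'
      proof -
        have "c0 * q powi (2 * int (2 * N)) < c0 * q powi (2 * int (2 * N') - 2)"
          using that c0_pos q_gt_1 by (simp add: powi_less_iff)
        then show ?thesis unfolding S_def by fastforce
      qed
      then show ?thesis using \<open>N \<noteq> N'\<close> by (metis Int_commute linorder_neqE_nat)
    qed
    show "\<exists>N0. \<forall>N\<ge>N0. q powi (4 * int N - k) / (4 * q) \<le> real (card (S (2 * N) \<inter> cyl k x))" for k x
    proof -
      obtain L0 where L0: "\<And>L. L \<ge> L0 \<Longrightarrow> q powi (2 * int L - k) / (4 * q) \<le> real (card (S L \<inter> cyl k x))"
        using S_ubiquity[OF S_fin] by blast
      have "q powi (4 * int N - k) / (4 * q) \<le> real (card (S (2 * N) \<inter> cyl k x))" if "N \<ge> L0" for N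
        using L0[of "2 * N"] that by simp
      then show ?thesis by (intro exI allI impI)
    qed
    have small: "q powi (- i N) \<le> \<eta>" "q powi (- i N) \<le> q powi (- int j)" for N
      using i(1)[of N] by (auto simp: \<tau>_def \<eta>'_def)
    show "\<rho> N \<ge> 4 * int N + int j" for N
      using small(2)[of N] by (simp add: \<rho>_def powi_le_iff[OF q_gt_1])
    show "q powi (4 * int N - \<rho> N) \<le> \<eta>" for N using small(1)[of N] by (simp add: \<rho>_def)
    show "\<not> summable (\<lambda>N. q powi (4 * int N - \<rho> N))" using not_summable by (simp add: \<rho>_def)
  qed
  from T.AE_hits_infinitely_often show ?thesis
  proof eventually_elim
    case (elim x)
    show ?case
    proof
      fix H
      obtain N1 :: nat where N1: "q powi (- int N1) < c0 / (\<bar>H\<bar> + 1)"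
        using exists_powi_less[OF q_gt_1, of "c0 / (\<bar>H\<bar> + 1)"] c0_pos by auto
      obtain N \<beta> where N: "N \<ge> N1 + 1" "\<beta> \<in> S (2 * N)" "x \<in> cyl (\<rho> N) \<beta>"
        using elim by blast
      define y where "y = (q ^ 4) ^ N"
      have y: "y > 0" "y = q powi (4 * int N)" using q_gt_1
        by (simp_all add: y_def power_int_def nat_mult_distrib flip: power_mult)
      have \<beta>: "\<beta> \<in> congruence_class \<alpha>" "c0 * (y / q\<^sup>2) \<le> height \<beta>" "height \<beta> \<le> c0 * y"
        using N(2) power_int_diff[of q "4 * int N" 2] q_gt_1 by (auto simp: S_def y(2))
      have h_pos: "height \<beta> > 0" by (rule height_pos[OF \<beta>(1)])
      have "\<bar>H\<bar> + 1 \<le> c0 * q powi int N1"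
        using N1 q_gt_1 by (simp add: power_int_minus field_simps)
      also have "\<dots> \<le> c0 * q powi (4 * int N - 2)"
        using N(1) c0_pos q_gt_1 by (simp add: powi_le_iff del: power_int_of_nat)
      also have "\<dots> \<le> height \<beta>" using N(2) by (auto simp: S_def)
      finally have "height \<beta> \<ge> H" by linarith
      moreover have "height \<beta> / \<phi> (height \<beta>) * abs_inf (x - \<beta>) \<le> \<epsilon>"
      proof -
        have "y \<le> R * height \<beta>"
        proof -
          have "y * q\<^sup>2 \<le> y * (R * c0)" using R(3) y(1) by (intro mult_left_mono) auto
          then have "y \<le> R * (c0 * (y / q\<^sup>2))" using q_gt_1 by (simp add: field_simps)
          also have "\<dots> \<le> R * height \<beta>" using \<beta>(2) R(1) by (intro mult_left_mono) auto
          finally show ?thesis .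
        qed
        moreover have "height \<beta> \<le> R * y"
          using \<beta>(3) mult_right_mono[OF R(2), of y] y(1) by linarith
        ultimately have \<Phi>: "\<Phi> N \<le> K * \<phi> (height \<beta>)"
          unfolding \<Phi>_def y_def[symmetric] by (intro K(2) y(1) h_pos)
        have \<phi>h: "\<phi> (height \<beta>) > 0" using pos h_pos by simp
        have "abs_inf (x - \<beta>) \<le> q powi (- \<rho> N)"
          using N(3) unfolding cyl_iff_abs_inf q_def[symmetric] by (simp add: abs_inf_diff_commute)
        also have "\<dots> = q powi (- i N) / y"
          using q_gt_1 power_int_diff[of q "- i N" "4 * int N"] by (simp add: \<rho>_def y(2) algebra_simps)
        also have "\<dots> \<le> b * \<Phi> N / y"
          using i(1)[of N] y(1) by (intro divide_right_mono) (auto simp: \<tau>_def)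
        also have "\<dots> \<le> b * (K * \<phi> (height \<beta>)) / y"
          using \<Phi> b y(1) by (intro divide_right_mono mult_left_mono) auto
        finally have "height \<beta> / \<phi> (height \<beta>) * abs_inf (x - \<beta>)
          \<le> (c0 * y) / \<phi> (height \<beta>) * (b * (K * \<phi> (height \<beta>)) / y)"
          using \<beta>(3) \<phi>h c0_pos y(1) by (intro mult_mono divide_right_mono) auto
        also have "\<dots> = \<epsilon>" using \<phi>h y(1) K(1) c0_pos by (simp add: b_def)
        finally show ?thesis .
      qed
      ultimately show "\<exists>\<beta>\<in>congruence_class \<alpha>. height \<beta> \<ge> H \<and>
          height \<beta> / \<phi> (height \<beta>) * abs_inf (x - \<beta>) \<le> \<epsilon>"
        using \<beta>(1) by blast
    qed
  qed
qed

end

text \<open>A monomial of degree exceeding the sizes of both roots balances the pair; \<epsilon>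
  then runs through 1 / (n + 1) to keep the exceptional sets countable in number.\<close>

theorem (in haar_fls) divergent_case:
  assumes pos: "\<And>t. t \<ge> 0 \<Longrightarrow> \<phi> t > 0" and lip: "l-lipschitz_on UNIV (\<lambda>u. ln (\<phi> (exp u)))"
    and nsumm: "\<not> summable (\<lambda>N. \<phi> ((q ^ 4) ^ N))" and \<alpha>: "\<alpha> \<in> quad_irr"
  shows "AE x in \<mu>. approx_liminf \<phi> (congruence_class \<alpha>) x = 0"
proof -
  obtain A B C where pair: "quadratic_pair \<alpha> (galois_conj \<alpha>) A B C" using quad_irr_pair[OF \<alpha>] .
  obtain e where e: "max (abs_inf \<alpha>) (abs_inf (galois_conj \<alpha>)) < q ^ e"
    using real_arch_pow[OF q_gt_1] by blast
  define p where "p = monom (1 :: 'a) (Suc e)"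
  have p: "abs_inf (emb_poly p) = q ^ Suc e"
    by (simp add: p_def abs_inf_emb_poly degree_monom_eq q_def monom_eq_0_iff del: power_Suc)
  have "q ^ e < q ^ Suc e" using q_gt_1 by simp
  then have "abs_inf \<alpha> < abs_inf (emb_poly p)" "abs_inf (galois_conj \<alpha>) < abs_inf (emb_poly p)"
    using e unfolding p by linarith+
  then have "abs_inf (\<alpha> + emb_poly p) = q ^ Suc e" "abs_inf (galois_conj \<alpha> + emb_poly p) = q ^ Suc e"
    using p abs_inf_add_eq(1) by metis+
  then interpret balanced_pair "\<alpha> + emb_poly p" "galois_conj \<alpha> + emb_poly p" A "B - (p + p) * A"
    "C - p * B + p * p * A" \<mu> M q "Suc e"
    using quadratic_pair_translate[OF pair, of p] haar_fls_axioms
    by (intro balanced_pair.intro balanced_pair_axioms.intro) auto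
  have "AE x in \<mu>. \<forall>n::nat. \<forall>H. \<exists>\<beta>\<in>congruence_class (\<alpha> + emb_poly p). height \<beta> \<ge> H \<and>
    height \<beta> / \<phi> (height \<beta>) * abs_inf (x - \<beta>) \<le> inverse (real (Suc n))"
    unfolding AE_all_countable by (intro allI AE_good_approximations[OF pos lip nsumm]) auto
  then show ?thesis
  proof eventually_elim
    case (elim x)
    show ?case
    proof (rule approx_liminf_eq_0[OF pos])
      fix \<epsilon> H :: real assume "\<epsilon> > 0"
      then obtain n where n: "inverse (real (Suc n)) < \<epsilon>" using reals_Archimedean by blast
      obtain \<beta> where "\<beta> \<in> congruence_class (\<alpha> + emb_poly p)" "height \<beta> \<ge> H"
        "height \<beta> / \<phi> (height \<beta>) * abs_inf (x - \<beta>) \<le> inverse (real (Suc n))"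
        using elim by blast
      with n congruence_class_translate[of \<alpha> p]
      show "\<exists>\<beta>\<in>congruence_class \<alpha>. height \<beta> \<ge> H \<and> height \<beta> / \<phi> (height \<beta>) * abs_inf (x - \<beta>) \<le> \<epsilon>"
        by (intro bexI[of _ \<beta>]) auto
    qed
  qed
qed

theorem theorem1p6:
  fixes \<mu> :: "'a::{field,finite} fls measure"
    and \<phi> :: "real \<Rightarrow> real"
  assumes "haar_measure \<mu>"
    and "\<And>t. t \<ge> 0 \<Longrightarrow> \<phi> t > 0"
    and "\<exists>L. L-lipschitz_on UNIV (\<lambda>u. ln (\<phi> (exp u)))"
  shows "((\<integral>\<^sup>+t\<in>{1..}. ennreal (\<phi> t / t) \<partial>lborel) = \<infinity> \<longrightarrow>
            (\<forall>C\<in>congruence_classes. AE x in \<mu>. approx_liminf \<phi> C x = 0)) \<and>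
         ((\<integral>\<^sup>+t\<in>{1..}. ennreal (\<phi> t / t) \<partial>lborel) < \<infinity> \<longrightarrow>
            (\<exists>C\<in>congruence_classes. AE x in \<mu>. approx_liminf \<phi> C x = \<infinity>))"
proof -
  let ?q = "real CARD('a)"
  obtain M where "haar_fls \<mu> M ?q" using haar_measure_haar_fls[OF assms(1)] .
  then interpret haar_fls \<mu> M ?q .
  obtain l where lip: "l-lipschitz_on UNIV (\<lambda>u. ln (\<phi> (exp u)))" using assms(3) by blast
  \<comment> \<open>Divergence is tested along q^(4N), the sampled heights; convergence along all
    powers of q, the possible heights.\<close>
  have q4: "?q ^ 4 > 1" using q_gt_1 by (intro one_less_power) auto
  obtain K where K: "K > 0"
    "\<And>s t. s > 0 \<Longrightarrow> t > 0 \<Longrightarrow> s \<le> ?q * t \<Longrightarrow> t \<le> ?q * s \<Longrightarrow> \<phi> s \<le> K * \<phi> t"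
    using log_lipschitz_comparable[OF assms(2) lip, of ?q] q_gt_1 by (metis less_imp_le)
  obtain K4 where K4: "K4 > 0"
    "\<And>s t. s > 0 \<Longrightarrow> t > 0 \<Longrightarrow> s \<le> ?q ^ 4 * t \<Longrightarrow> t \<le> ?q ^ 4 * s \<Longrightarrow> \<phi> s \<le> K4 * \<phi> t"
    using log_lipschitz_comparable[OF assms(2) lip, of "?q ^ 4"] q4 by (metis less_imp_le)
  obtain \<alpha>0 :: "'a fls" where \<alpha>0: "\<alpha>0 \<in> quad_irr" using quad_irr_nonempty by blast
  show ?thesis
  proof (intro conjI impI)
    assume inf: "(\<integral>\<^sup>+t\<in>{1..}. ennreal (\<phi> t / t) \<partial>lborel) = \<infinity>"
    have ns: "\<not> summable (\<lambda>N. \<phi> ((?q ^ 4) ^ N))"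
      by (rule integral_infinite_imp_not_summable[OF assms(2) q4 K4 inf])
    show "\<forall>C\<in>congruence_classes. AE x in \<mu>. approx_liminf \<phi> C x = 0"
      unfolding congruence_classes_def
    proof (intro ballI, elim imageE)
      fix C \<alpha> assume "C = congruence_class \<alpha>" "(\<alpha> :: 'a fls) \<in> quad_irr"
      then show "AE x in \<mu>. approx_liminf \<phi> C x = 0"
        using divergent_case[OF assms(2) lip ns] by blast
    qed
  next
    assume fin: "(\<integral>\<^sup>+t\<in>{1..}. ennreal (\<phi> t / t) \<partial>lborel) < \<infinity>"
    have summ: "summable (\<lambda>n. \<phi> (?q ^ n))"
      by (rule integral_finite_imp_summable[OF assms(2) q_gt_1 K fin])
    have "AE x in \<mu>. approx_liminf \<phi> (congruence_class \<alpha>0) x = \<infinity>"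
      by (rule convergent_case[OF assms(2) summ \<alpha>0])
    then show "\<exists>C\<in>congruence_classes. AE x in \<mu>. approx_liminf \<phi> C x = \<infinity>"
      unfolding congruence_classes_def by (intro bexI[of _ "congruence_class \<alpha>0"] imageI \<alpha>0)
  qed
qed

end
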